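(* Let $B_R\subset\mathbb{R}^2$ be the open disc centred at the origin with radius $R>1$. Then the unique negative eigenvalue $\tilde\tau_1(B_R)$ of $\mathcal{L}$ on $L^2(B_R)$ and the corresponding eigenfunction $\tilde u$ (up to a constant multiple) are given by $$\tilde\tau_1(B_R)=-\frac{R^2}{\mu_0(B_R)^2},\qquad \tilde u(x)=I_0\!\left(\frac{\mu_0(B_R)}{R}|x|\right),$$ where $\mu_0(B_R)$ is the unique root in $(0,\infty)$ of the equation $I_0(t)-(\log R)\,t\,I_0'(t)=0$. Moreover, if $1<R_1<R_2$, then $\mu_0(B_{R_2})<\mu_0(B_{R_1})$.
   Context: For a bounded open set $\Omega\subset\mathbb{R}^2$, the Logarithmic potential operator $\mathcal{L}$ on $L^2(\Omega)$ is the self-adjoint compact operator $\mathcal{L}u(x)=\frac{1}{2\pi}\int_\Omega \log\frac{1}{|x-y|}\,u(y)\,dy$. One sets $\tilde\tau_1(\Omega):=\inf\{E(u):u\in L^2(\Omega),\ \|u\|_{L^2(\Omega)}=1\}$, where $E(u)=\frac{1}{2\pi}\int_\Omega\int_\Omega\log\frac{1}{|x-y|}u(x)u(y)\,dx\,dy$. $I_0(x)=\sum_{m=0}^\infty\frac{x^{2m}}{2^{2m}(m!)^2}$ is the modified Bessel function of order zero. *)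

theory Defs
  imports "HOL-Analysis.Analysis"
begin

text \<open>The elements of \<open>L\<^sup>2(\<Omega>)\<close> are represented by real-valued Lebesgue measurable functions; only
  their values on \<open>\<Omega>\<close> matter, and equality in \<open>L\<^sup>2(\<Omega>)\<close> is equality almost everywhere on \<open>\<Omega>\<close>.\<close>

definition L2 :: "(real ^ 2) set \<Rightarrow> (real ^ 2 \<Rightarrow> real) set" where
  "L2 \<Omega> = {u. u \<in> borel_measurable (lebesgue_on \<Omega>) \<and> integrable (lebesgue_on \<Omega>) (\<lambda>x. (u x)\<^sup>2)}"

definition L2_norm :: "(real ^ 2) set \<Rightarrow> (real ^ 2 \<Rightarrow> real) \<Rightarrow> real" where
  "L2_norm \<Omega> u = sqrt (LINT x|lebesgue_on \<Omega>. (u x)\<^sup>2)"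

text \<open>The integrand on the diagonal \<open>y = x\<close> is \<open>ln (1 / 0) = 0\<close>, on a null set. For nonempty bounded open
  \<open>\<Omega>\<close> and \<open>u \<in> L2 \<Omega>\<close> all integrals below converge and the infimum in \<open>tau1\<close> is over a bounded set,
  so no default value of a total function intervenes.\<close>

definition log_potential :: "(real ^ 2) set \<Rightarrow> (real ^ 2 \<Rightarrow> real) \<Rightarrow> real ^ 2 \<Rightarrow> real" where
  "log_potential \<Omega> u x = 1 / (2 * pi) * (LINT y|lebesgue_on \<Omega>. ln (1 / norm (x - y)) * u y)"

definition log_energy :: "(real ^ 2) set \<Rightarrow> (real ^ 2 \<Rightarrow> real) \<Rightarrow> real" where
  "log_energy \<Omega> u =
     1 / (2 * pi) * (LINT x|lebesgue_on \<Omega>. LINT y|lebesgue_on \<Omega>. ln (1 / norm (x - y)) * u x * u y)"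

definition tau1 :: "(real ^ 2) set \<Rightarrow> real" where
  "tau1 \<Omega> = Inf {log_energy \<Omega> u | u. u \<in> L2 \<Omega> \<and> L2_norm \<Omega> u = 1}"

definition eigenfunction :: "(real ^ 2) set \<Rightarrow> real \<Rightarrow> (real ^ 2 \<Rightarrow> real) \<Rightarrow> bool" where
  "eigenfunction \<Omega> \<tau> u \<longleftrightarrow>
     u \<in> L2 \<Omega> \<and> \<not> (AE x in lebesgue_on \<Omega>. u x = 0) \<and>
     (AE x in lebesgue_on \<Omega>. log_potential \<Omega> u x = \<tau> * u x)"

definition eigenvalue :: "(real ^ 2) set \<Rightarrow> real \<Rightarrow> bool" where
  "eigenvalue \<Omega> \<tau> \<longleftrightarrow> (\<exists>u. eigenfunction \<Omega> \<tau> u)"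

definition bessel_I0 :: "real \<Rightarrow> real" where
  "bessel_I0 x = (\<Sum>m. x ^ (2 * m) / (2 ^ (2 * m) * (fact m)\<^sup>2))"

definition mu0_root :: "real \<Rightarrow> real \<Rightarrow> bool" where
  "mu0_root R t \<longleftrightarrow> 0 < t \<and> bessel_I0 t - ln R * t * deriv bessel_I0 t = 0"

definition mu0 :: "real \<Rightarrow> real" where
  "mu0 R = (THE t. mu0_root R t)"

end

theory Submission
  imports Defs
begin

text \<open>
  Write \<open>K x y = ln (1 / norm (x - y))\<close> and let \<open>w x = I\<^sub>0 (k * norm x)\<close> with
  \<open>k = mu0 R / R\<close>. The proof has two independent parts: \<open>w\<close> is an eigenfunction with a negative
  eigenvalue, and the quadratic form of \<open>K\<close> has at most one negative direction.

  The function \<open>w\<close> is radial, so its logarithmic potential at \<open>x\<close> only involves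
  \<open>ln (max (norm x) (norm y))\<close> in place of \<open>ln (norm (x - y))\<close> (\<open>integral_ln_dist_radial\<close>). This is
  proved without polar coordinates: the mean of \<open>ln (norm (x - y))\<close> over the rotations of \<open>y\<close> by the
  \<open>N\<close>-th roots of unity is the \<open>N\<close>-th part of the logarithm of \<open>\<bar>x ^ N - y ^ N\<bar>\<close>, computed in
  the complex plane, and tends to \<open>ln (max \<bar>x\<bar> \<bar>y\<bar>)\<close>. The remaining radial
  integrals reduce by Tonelli to areas of discs (\<open>radial_layer_cake\<close>) and are evaluated with the Bessel equation. The potential of \<open>w\<close> turns out
  to be \<open>- w / k\<^sup>2\<close> plus a constant that vanishes exactly by the equation for \<open>mu0 R\<close>
  (\<open>log_potential_bessel\<close>).

  The quadratic form of \<open>K\<close> is nonnegative on functions of mean zero (\<open>log_form_nonneg\<close>).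
  Stereographic projection writes \<open>norm (x - y)\<^sup>2\<close> as \<open>(1 + norm x\<^sup>2) (1 + norm y\<^sup>2) (1 - s)\<close>, where
  \<open>s\<close> is a positive semidefinite kernel with values in \<open>[0, 1]\<close>. The two factors contribute nothing to
  the form on mean-zero functions, and \<open>- ln (1 - s)\<close> is the sum of the positive semidefinite kernels
  \<open>s ^ n / n\<close>. Consequently the form is nonnegative on the orthogonal complement of
  \<open>w\<close>, since otherwise it would be negative definite on a plane, which contains a nonzero function of mean zero. Expanding along \<open>w\<close>
  identifies the infimum and shows that every negative eigenvalue is that of \<open>w\<close> and is simple
  (locale \<open>one_negative_direction\<close>).

  Finally, the root equation is settled by monotonicity: the quotient \<open>t I\<^sub>0' t / I\<^sub>0 t\<close>
  increases strictly from \<open>0\<close> to infinity, so it takes the value \<open>1 / ln R\<close> exactly once, at a point that decreases as \<open>R\<close> grows.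
\<close>

section \<open>Symmetric kernels with at most one negative direction\<close>

definition sq_integrable :: "'a measure \<Rightarrow> ('a \<Rightarrow> real) \<Rightarrow> bool" where
  "sq_integrable M u \<longleftrightarrow> u \<in> borel_measurable M \<and> integrable M (\<lambda>x. (u x)\<^sup>2)"

lemma sq_integrable_measurable [measurable_dest]:
  "sq_integrable M u \<Longrightarrow> u \<in> borel_measurable M"
  by (simp add: sq_integrable_def)

lemma abs_mult_le_sum_squares: "\<bar>a * b\<bar> \<le> a\<^sup>2 + b\<^sup>2" for a b :: real
proof -
  have "2 * (\<bar>a\<bar> * \<bar>b\<bar>) \<le> a\<^sup>2 + b\<^sup>2"
    using sum_squares_bound[of "\<bar>a\<bar>" "\<bar>b\<bar>"] by simp
  moreover have "0 \<le> \<bar>a\<bar> * \<bar>b\<bar>" by simp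
  ultimately show ?thesis unfolding abs_mult by linarith
qed

lemma sq_integrable_mult:
  assumes [measurable]: "sq_integrable M u" "sq_integrable M v"
  shows "integrable M (\<lambda>x. u x * v x)"
proof (rule Bochner_Integration.integrable_bound)
  show "integrable M (\<lambda>x. (u x)\<^sup>2 + (v x)\<^sup>2)"
    using assms by (simp add: sq_integrable_def)
  show "AE x in M. norm (u x * v x) \<le> norm ((u x)\<^sup>2 + (v x)\<^sup>2)"
    by (auto intro!: AE_I2 abs_mult_le_sum_squares)
qed simp

lemma sq_integrable_lincomb:
  assumes [measurable]: "sq_integrable M u" "sq_integrable M v"
  shows "sq_integrable M (\<lambda>x. a * u x + b * v x)"
proof -
  have "integrable M (\<lambda>x. a\<^sup>2 * (u x)\<^sup>2 + (b\<^sup>2 * (v x)\<^sup>2 + (2 * a * b) * (u x * v x)))"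
    using assms sq_integrable_mult[OF assms]
    by (intro Bochner_Integration.integrable_add integrable_mult_right) (auto simp: sq_integrable_def)
  also have "(\<lambda>x. a\<^sup>2 * (u x)\<^sup>2 + (b\<^sup>2 * (v x)\<^sup>2 + (2 * a * b) * (u x * v x)))
           = (\<lambda>x. (a * u x + b * v x)\<^sup>2)"
    by (simp add: power2_eq_square algebra_simps)
  finally show ?thesis
    by (simp add: sq_integrable_def)
qed

lemma integral_lincomb_square:
  assumes "sq_integrable M u" "sq_integrable M v"
  shows "(LINT x|M. (a * u x + b * v x)\<^sup>2)
       = a\<^sup>2 * (LINT x|M. (u x)\<^sup>2) + 2 * a * b * (LINT x|M. u x * v x) + b\<^sup>2 * (LINT x|M. (v x)\<^sup>2)"
proof -
  have "(LINT x|M. (a * u x + b * v x)\<^sup>2)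
      = (LINT x|M. a\<^sup>2 * (u x)\<^sup>2 + (2 * a * b * (u x * v x) + b\<^sup>2 * (v x)\<^sup>2))"
    by (simp add: power2_eq_square algebra_simps)
  also have "\<dots> = (LINT x|M. a\<^sup>2 * (u x)\<^sup>2) + (LINT x|M. 2 * a * b * (u x * v x) + b\<^sup>2 * (v x)\<^sup>2)"
    using assms sq_integrable_mult[OF assms]
    by (intro Bochner_Integration.integral_add) (auto simp: sq_integrable_def)
  also have "(LINT x|M. 2 * a * b * (u x * v x) + b\<^sup>2 * (v x)\<^sup>2)
      = (LINT x|M. 2 * a * b * (u x * v x)) + (LINT x|M. b\<^sup>2 * (v x)\<^sup>2)"
    using assms sq_integrable_mult[OF assms]
    by (intro Bochner_Integration.integral_add) (auto simp: sq_integrable_def)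
  finally show ?thesis
    by simp
qed

lemma (in finite_measure) sq_integrable_imp_integrable:
  assumes "sq_integrable M u"
  shows "integrable M u"
  using sq_integrable_mult[OF assms, of "\<lambda>_. 1"] by (simp add: sq_integrable_def)

text \<open>A symmetric kernel whose absolute row integrals are bounded: by Schur's test it acts boundedly on
\<open>L\<^sup>2\<close>. The logarithmic kernel is unbounded, so this is the right substitute for a bounded kernel.\<close>

locale schur_kernel = finite_measure M
  for M :: "'a measure" +
  fixes K :: "'a \<Rightarrow> 'a \<Rightarrow> real" and C :: real
  assumes kernel_measurable [measurable]: "case_prod K \<in> borel_measurable (M \<Otimes>\<^sub>M M)"
    and kernel_sym: "K x y = K y x"
    and kernel_bound: "x \<in> space M \<Longrightarrow> (\<integral>\<^sup>+ y. ennreal \<bar>K x y\<bar> \<partial>M) \<le> ennreal C"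
begin

sublocale pair: pair_sigma_finite M M ..

definition form :: "('a \<Rightarrow> real) \<Rightarrow> ('a \<Rightarrow> real) \<Rightarrow> real" where
  "form u v = (LINT x|M. LINT y|M. K x y * u x * v y)"

text \<open>Together with \<open>\<bar>u v\<bar> \<le> u\<^sup>2 + v\<^sup>2\<close> these two bounds make \<open>K x y * u x * v y\<close> integrable on the product
space, which is all that Fubini needs. The second integral becomes the first by symmetry of the kernel.\<close>

lemma nn_integral_kernel_sq:
  assumes u: "sq_integrable M u"
  shows "(\<integral>\<^sup>+ p. ennreal (\<bar>K (fst p) (snd p)\<bar> * (u (fst p))\<^sup>2) \<partial>(M \<Otimes>\<^sub>M M)) < \<infinity>"
    and "(\<integral>\<^sup>+ p. ennreal (\<bar>K (fst p) (snd p)\<bar> * (u (snd p))\<^sup>2) \<partial>(M \<Otimes>\<^sub>M M)) < \<infinity>"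
proof -
  note [measurable] = sq_integrable_measurable[OF u]
  define I where "I = (\<integral>\<^sup>+ x. \<integral>\<^sup>+ y. ennreal (\<bar>K x y\<bar> * (u x)\<^sup>2) \<partial>M \<partial>M)"
  have "I \<le> (\<integral>\<^sup>+ x. ennreal C * ennreal ((u x)\<^sup>2) \<partial>M)"
    unfolding I_def
  proof (rule nn_integral_mono)
    fix x assume x: "x \<in> space M"
    have "(\<integral>\<^sup>+ y. ennreal (\<bar>K x y\<bar> * (u x)\<^sup>2) \<partial>M) = (\<integral>\<^sup>+ y. ennreal \<bar>K x y\<bar> \<partial>M) * ennreal ((u x)\<^sup>2)"
      using x by (subst nn_integral_multc[symmetric]) (auto simp: ennreal_mult)
    also have "\<dots> \<le> ennreal C * ennreal ((u x)\<^sup>2)"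
      by (intro mult_right_mono kernel_bound x) auto
    finally show "(\<integral>\<^sup>+ y. ennreal (\<bar>K x y\<bar> * (u x)\<^sup>2) \<partial>M) \<le> ennreal C * ennreal ((u x)\<^sup>2)" .
  qed
  also have "\<dots> = ennreal C * (\<integral>\<^sup>+ x. ennreal ((u x)\<^sup>2) \<partial>M)"
    by (intro nn_integral_cmult) auto
  also have "\<dots> < \<infinity>"
    using u by (simp add: ennreal_mult_less_top sq_integrable_def real_integrable_def less_top)
  finally have I: "I < \<infinity>" .
  have "(\<integral>\<^sup>+ p. ennreal (\<bar>K (fst p) (snd p)\<bar> * (u (fst p))\<^sup>2) \<partial>(M \<Otimes>\<^sub>M M)) = I"
    unfolding I_def
    by (subst nn_integral_fst[of "\<lambda>p. ennreal (\<bar>K (fst p) (snd p)\<bar> * (u (fst p))\<^sup>2)", symmetric]) auto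
  then show "(\<integral>\<^sup>+ p. ennreal (\<bar>K (fst p) (snd p)\<bar> * (u (fst p))\<^sup>2) \<partial>(M \<Otimes>\<^sub>M M)) < \<infinity>"
    using I by simp
  have "(\<integral>\<^sup>+ p. ennreal (\<bar>K (fst p) (snd p)\<bar> * (u (snd p))\<^sup>2) \<partial>(M \<Otimes>\<^sub>M M))
      = (\<integral>\<^sup>+ y. \<integral>\<^sup>+ x. ennreal (\<bar>K x y\<bar> * (u y)\<^sup>2) \<partial>M \<partial>M)"
    by (subst pair.nn_integral_snd[of "\<lambda>p. ennreal (\<bar>K (fst p) (snd p)\<bar> * (u (snd p))\<^sup>2)", symmetric])
      auto
  also have "\<dots> = I"
    unfolding I_def by (simp add: kernel_sym)
  finally show "(\<integral>\<^sup>+ p. ennreal (\<bar>K (fst p) (snd p)\<bar> * (u (snd p))\<^sup>2) \<partial>(M \<Otimes>\<^sub>M M)) < \<infinity>"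
    using I by simp
qed

lemma integrable_kernel:
  assumes u: "sq_integrable M u" and v: "sq_integrable M v"
  shows "integrable (M \<Otimes>\<^sub>M M) (\<lambda>(x, y). K x y * u x * v y)"
proof (rule Bochner_Integration.integrable_bound)
  note [measurable] = sq_integrable_measurable[OF u] sq_integrable_measurable[OF v]
  show "integrable (M \<Otimes>\<^sub>M M) (\<lambda>p. \<bar>K (fst p) (snd p)\<bar> * (u (fst p))\<^sup>2 + \<bar>K (fst p) (snd p)\<bar> * (v (snd p))\<^sup>2)"
    using nn_integral_kernel_sq(1)[OF u] nn_integral_kernel_sq(2)[OF v]
    by (intro Bochner_Integration.integrable_add integrableI_nonneg) auto
  have "\<bar>k * a * b\<bar> \<le> \<bar>k\<bar> * a\<^sup>2 + \<bar>k\<bar> * b\<^sup>2" for a b k :: real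
  proof -
    have "\<bar>k\<bar> * \<bar>a * b\<bar> \<le> \<bar>k\<bar> * (a\<^sup>2 + b\<^sup>2)"
      by (intro mult_left_mono abs_mult_le_sum_squares) auto
    then show ?thesis by (simp add: abs_mult algebra_simps)
  qed
  then show "AE p in M \<Otimes>\<^sub>M M. norm (case p of (x, y) \<Rightarrow> K x y * u x * v y)
      \<le> norm (\<bar>K (fst p) (snd p)\<bar> * (u (fst p))\<^sup>2 + \<bar>K (fst p) (snd p)\<bar> * (v (snd p))\<^sup>2)"
    by (auto intro!: AE_I2)
  show "(\<lambda>(x, y). K x y * u x * v y) \<in> borel_measurable (M \<Otimes>\<^sub>M M)"
    by measurable
qed

lemma form_eq_product_integral:
  assumes "sq_integrable M u" "sq_integrable M v"
  shows "form u v = (LINT p|(M \<Otimes>\<^sub>M M). K (fst p) (snd p) * u (fst p) * v (snd p))"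
  unfolding form_def using pair.integral_fst[OF integrable_kernel[OF assms]]
  by (simp add: split_beta')

lemma form_sym:
  assumes "sq_integrable M u" "sq_integrable M v"
  shows "form u v = form v u"
proof -
  have "form u v = (LINT y|M. LINT x|M. K x y * u x * v y)"
    unfolding form_def by (rule pair.Fubini_integral[symmetric]) (rule integrable_kernel[OF assms])
  also have "\<dots> = form v u"
    unfolding form_def
    by (intro Bochner_Integration.integral_cong refl) (simp add: kernel_sym mult_ac)
  finally show ?thesis .
qed

lemma form_lincomb_left:
  assumes "sq_integrable M u" "sq_integrable M v" "sq_integrable M w"
  shows "form (\<lambda>x. a * u x + b * v x) w = a * form u w + b * form v w"
proof -
  have iu: "integrable (M \<Otimes>\<^sub>M M) (\<lambda>p. K (fst p) (snd p) * u (fst p) * w (snd p))"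
    and iv: "integrable (M \<Otimes>\<^sub>M M) (\<lambda>p. K (fst p) (snd p) * v (fst p) * w (snd p))"
    using integrable_kernel[OF assms(1,3)] integrable_kernel[OF assms(2,3)]
    by (simp_all add: split_beta')
  have "form (\<lambda>x. a * u x + b * v x) w
      = (LINT p|(M \<Otimes>\<^sub>M M). a * (K (fst p) (snd p) * u (fst p) * w (snd p)) +
                          b * (K (fst p) (snd p) * v (fst p) * w (snd p)))"
    by (subst form_eq_product_integral) (auto intro!: sq_integrable_lincomb assms simp: algebra_simps)
  also have "\<dots> = a * form u w + b * form v w"
    using iu iv by (simp add: form_eq_product_integral assms)
  finally show ?thesis .
qed

lemma form_lincomb_square:
  assumes u: "sq_integrable M u" and v: "sq_integrable M v"
  shows "form (\<lambda>x. a * u x + b * v x) (\<lambda>x. a * u x + b * v x)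
       = a\<^sup>2 * form u u + 2 * a * b * form u v + b\<^sup>2 * form v v"
proof -
  let ?z = "\<lambda>x. a * u x + b * v x"
  have z: "sq_integrable M ?z" by (intro sq_integrable_lincomb u v)
  have "form u ?z = a * form u u + b * form u v" "form v ?z = a * form u v + b * form v v"
    using form_lincomb_left[OF u v u, of a b] form_lincomb_left[OF u v v, of a b]
    by (simp_all add: form_sym[OF _ z] form_sym[OF v u] u v)
  then show ?thesis
    by (simp add: form_lincomb_left[OF u v z] power2_eq_square algebra_simps)
qed

lemma form_eigen_right:
  assumes u: "sq_integrable M u" and w: "sq_integrable M w"
    and eigen: "AE x in M. (LINT y|M. K x y * w y) = \<tau> * w x"
  shows "form u w = \<tau> * (LINT x|M. u x * w x)"
proof -
  note [measurable] = sq_integrable_measurable[OF u] sq_integrable_measurable[OF w]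
  have "form u w = (LINT x|M. u x * (LINT y|M. K x y * w y))"
    unfolding form_def by (simp add: mult.assoc mult.left_commute flip: integral_mult_right_zero)
  also have "\<dots> = (LINT x|M. \<tau> * (u x * w x))"
    using eigen by (intro integral_cong_AE) auto
  finally show ?thesis by simp
qed

end

text \<open>The spectral argument, free of compactness. The form is nonnegative on the hyperplane of mean-zero
functions, so it cannot be negative definite on a plane: every plane meets that hyperplane outside the origin. One
eigenfunction \<open>w\<close> with a negative eigenvalue therefore uses up all negativity of the form, and everything
about the bottom of the spectrum follows by elementary algebra.\<close>

locale one_negative_direction = schur_kernel +
  fixes w :: "'a \<Rightarrow> real" and \<kappa> :: real
  assumes cond_nonneg: "\<lbrakk>sq_integrable M u; (LINT x|M. u x) = 0\<rbrakk> \<Longrightarrow> form u u \<ge> 0"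
    and w_sq: "sq_integrable M w" and w_pos: "(LINT x|M. (w x)\<^sup>2) > 0"
    and \<kappa>_pos: "\<kappa> > 0"
    and w_eigen: "AE x in M. (LINT y|M. K x y * w y) = - \<kappa> * w x"
begin

lemma form_w: "sq_integrable M u \<Longrightarrow> form u w = - \<kappa> * (LINT x|M. u x * w x)"
  by (rule form_eigen_right[OF _ w_sq w_eigen])

text \<open>If the form were negative at some \<open>u\<close> orthogonal to \<open>w\<close>, it would be negative definite on the span of
\<open>u\<close> and \<open>w\<close>, since the two are also orthogonal for the form. The combination \<open>v\<close> below lies in that
span and has mean zero.\<close>

lemma form_nonneg_perp:
  assumes u: "sq_integrable M u" and perp: "(LINT x|M. u x * w x) = 0"
  shows "form u u \<ge> 0"
proof (rule ccontr)
  assume neg: "\<not> form u u \<ge> 0"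
  define a b where "a = (LINT x|M. w x)" and "b = - (LINT x|M. u x)"
  define v where "v = (\<lambda>x. a * u x + b * w x)"
  have ww: "form w w = - \<kappa> * (LINT x|M. (w x)\<^sup>2)"
    using form_w[OF w_sq] by (simp add: power2_eq_square)
  then have ww_neg: "form w w < 0"
    using \<kappa>_pos w_pos by simp
  have "(LINT x|M. v x) = 0"
    unfolding v_def
    using sq_integrable_imp_integrable[OF u] sq_integrable_imp_integrable[OF w_sq]
    by (simp add: a_def b_def)
  then have "form v v \<ge> 0"
    unfolding v_def by (intro cond_nonneg sq_integrable_lincomb u w_sq)
  moreover have "form v v = a\<^sup>2 * form u u + b\<^sup>2 * form w w"
    unfolding v_def by (simp add: form_lincomb_square u w_sq form_w perp)
  moreover have "a \<noteq> 0"
    using cond_nonneg[OF w_sq] ww_neg by (auto simp: a_def)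
  then have "a\<^sup>2 * form u u < 0"
    using neg by (simp add: mult_pos_neg)
  moreover have "b\<^sup>2 * form w w \<le> 0"
    using ww_neg by (simp add: mult_nonneg_nonpos)
  ultimately show False by linarith
qed

text \<open>Both the form and the norm split along the decomposition of \<open>u\<close> into its projection \<open>p w\<close> and an
orthogonal remainder, on which the form is nonnegative. The coefficient \<open>1\<close> is kept so that the
lemmas on linear combinations apply verbatim.\<close>

lemma perp_projection:
  fixes u
  defines "p \<equiv> (LINT x|M. u x * w x) / (LINT x|M. (w x)\<^sup>2)"
  assumes u: "sq_integrable M u"
  shows "form (\<lambda>x. 1 * u x + (- p) * w x) (\<lambda>x. 1 * u x + (- p) * w x) \<ge> 0"
    and "form (\<lambda>x. 1 * u x + (- p) * w x) (\<lambda>x. 1 * u x + (- p) * w x)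
       = form u u + \<kappa> * p\<^sup>2 * (LINT x|M. (w x)\<^sup>2)"
    and "(LINT x|M. (1 * u x + (- p) * w x)\<^sup>2)
       = (LINT x|M. (u x)\<^sup>2) - p\<^sup>2 * (LINT x|M. (w x)\<^sup>2)"
proof -
  have p: "(LINT x|M. u x * w x) = p * (LINT x|M. (w x)\<^sup>2)"
    using w_pos by (simp add: p_def)
  have ww: "form w w = - \<kappa> * (LINT x|M. (w x)\<^sup>2)"
    using form_w[OF w_sq] by (simp add: power2_eq_square)
  have "(LINT x|M. (1 * u x + (- p) * w x) * w x)
      = (LINT x|M. u x * w x + (- p) * (w x)\<^sup>2)"
    by (simp add: power2_eq_square algebra_simps)
  also have "\<dots> = 0"
    using sq_integrable_mult[OF u w_sq] w_sq
    by (subst Bochner_Integration.integral_add) (auto simp: sq_integrable_def p)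
  finally show "form (\<lambda>x. 1 * u x + (- p) * w x) (\<lambda>x. 1 * u x + (- p) * w x) \<ge> 0"
    by (intro form_nonneg_perp sq_integrable_lincomb u w_sq)
  show "form (\<lambda>x. 1 * u x + (- p) * w x) (\<lambda>x. 1 * u x + (- p) * w x)
       = form u u + \<kappa> * p\<^sup>2 * (LINT x|M. (w x)\<^sup>2)"
    unfolding form_lincomb_square[OF u w_sq] form_w[OF u] ww p
    by (simp add: power2_eq_square algebra_simps)
  show "(LINT x|M. (1 * u x + (- p) * w x)\<^sup>2)
       = (LINT x|M. (u x)\<^sup>2) - p\<^sup>2 * (LINT x|M. (w x)\<^sup>2)"
    unfolding integral_lincomb_square[OF u w_sq] p
    by (simp add: power2_eq_square algebra_simps)
qed

lemma form_lower_bound: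
  assumes u: "sq_integrable M u"
  shows "form u u \<ge> - \<kappa> * (LINT x|M. (u x)\<^sup>2)"
proof -
  define p where "p = (LINT x|M. u x * w x) / (LINT x|M. (w x)\<^sup>2)"
  note P = perp_projection[OF u, folded p_def]
  have "(LINT x|M. (1 * u x + (- p) * w x)\<^sup>2) \<ge> 0"
    by (rule Bochner_Integration.integral_nonneg) auto
  then have "\<kappa> * (p\<^sup>2 * (LINT x|M. (w x)\<^sup>2)) \<le> \<kappa> * (LINT x|M. (u x)\<^sup>2)"
    using \<kappa>_pos unfolding P(3) by simp
  then show ?thesis
    using P(1) unfolding P(2) by (simp add: mult.assoc)
qed

lemma sq_integral_zero_iff:
  assumes "sq_integrable M u"
  shows "(LINT x|M. (u x)\<^sup>2) = 0 \<longleftrightarrow> (AE x in M. u x = 0)"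
  using assms by (subst integral_nonneg_eq_0_iff_AE) (auto simp: sq_integrable_def)

text \<open>Symmetry makes eigenfunctions of different eigenvalues orthogonal, and orthogonality to \<open>w\<close> would
force \<open>form u u \<ge> 0\<close>; hence the eigenvalue is that of \<open>w\<close>. The remainder of \<open>u\<close> after projection to
\<open>w\<close> then has form \<open>- \<kappa>\<close> times its squared norm, which must be nonnegative, so it vanishes.\<close>

lemma negative_eigenfunction:
  assumes u: "sq_integrable M u" and u0: "\<not> (AE x in M. u x = 0)" and "\<tau> < 0"
    and eigen: "AE x in M. (LINT y|M. K x y * u y) = \<tau> * u x"
  shows "\<tau> = - \<kappa>" and "\<exists>c. c \<noteq> 0 \<and> (AE x in M. u x = c * w x)"
proof -
  define p where "p = (LINT x|M. u x * w x) / (LINT x|M. (w x)\<^sup>2)"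
  note P = perp_projection[OF u, folded p_def]
  have uu: "form u u = \<tau> * (LINT x|M. (u x)\<^sup>2)"
    using form_eigen_right[OF u u eigen] by (simp add: power2_eq_square)
  have "(LINT x|M. (u x)\<^sup>2) \<ge> 0"
    by (rule Bochner_Integration.integral_nonneg) auto
  then have u_pos: "(LINT x|M. (u x)\<^sup>2) > 0"
    using sq_integral_zero_iff[OF u] u0 by linarith
  have nonzero: "(LINT x|M. u x * w x) \<noteq> 0"
  proof
    assume "(LINT x|M. u x * w x) = 0"
    then have "form u u \<ge> 0" by (rule form_nonneg_perp[OF u])
    moreover have "\<tau> * (LINT x|M. (u x)\<^sup>2) < 0"
      using u_pos \<open>\<tau> < 0\<close> by (simp add: mult_neg_pos)
    ultimately show False
      using uu by simp
  qed
  have "form w u = form u w"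
    by (rule form_sym[OF w_sq u])
  then have "(\<tau> + \<kappa>) * (LINT x|M. u x * w x) = 0"
    using form_eigen_right[OF w_sq u eigen] form_w[OF u]
    by (simp add: mult.commute[of "w _"] algebra_simps)
  with nonzero show tau: "\<tau> = - \<kappa>"
    by (simp add: eq_neg_iff_add_eq_0)
  have "p \<noteq> 0"
    using nonzero w_pos by (simp add: p_def)
  have "- \<kappa> * (LINT x|M. (1 * u x + (- p) * w x)\<^sup>2) \<ge> 0"
    using P(1) unfolding P(2,3) uu tau by (simp add: algebra_simps)
  then have "(LINT x|M. (1 * u x + (- p) * w x)\<^sup>2) \<le> 0"
    using \<kappa>_pos by (simp add: mult_le_0_iff)
  moreover have "(LINT x|M. (1 * u x + (- p) * w x)\<^sup>2) \<ge> 0"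
    by (rule Bochner_Integration.integral_nonneg) auto
  ultimately have "(LINT x|M. (1 * u x + (- p) * w x)\<^sup>2) = 0"
    by linarith
  then have "AE x in M. 1 * u x + (- p) * w x = 0"
    by (subst (asm) sq_integral_zero_iff) (rule sq_integrable_lincomb u w_sq)+
  then have "AE x in M. u x = p * w x"
    by eventually_elim simp
  with \<open>p \<noteq> 0\<close> show "\<exists>c. c \<noteq> 0 \<and> (AE x in M. u x = c * w x)"
    by blast
qed

end

section \<open>A positive semidefinite kernel from stereographic projection\<close>

text \<open>The four values are affine functions of the point of the unit sphere that inverse stereographic
projection assigns to \<open>x\<close>. If \<open>\<xi>, \<eta>\<close> are the points assigned to \<open>x, y\<close>, then the kernel built from
them is \<open>(1 + \<xi> \<bullet> \<eta>) / 2\<close>.\<close>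

definition chordal :: "nat \<Rightarrow> real ^ 2 \<Rightarrow> real" where
  "chordal i x = (if i = 0 then 1 else if i = 1 then (norm x)\<^sup>2
     else if i = 2 then sqrt 2 * x $ 1 else sqrt 2 * x $ 2) / (1 + (norm x)\<^sup>2)"

definition chordal_kernel :: "real ^ 2 \<Rightarrow> real ^ 2 \<Rightarrow> real" where
  "chordal_kernel x y = (\<Sum>i<4. chordal i x * chordal i y)"

lemma norm_vec2_sq: "(norm x)\<^sup>2 = (x $ 1)\<^sup>2 + (x $ 2)\<^sup>2" for x :: "real ^ 2"
  by (simp add: norm_eq_sqrt_inner inner_vec_def sum_2 power2_eq_square)

text \<open>The conformal factor formula for the chordal distance. Taking logarithms, \<open>2 ln (1 / norm (x - y))\<close>
equals \<open>- ln (1 - chordal_kernel x y)\<close> up to a function of \<open>x\<close> plus a function of \<open>y\<close>, and such terms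
are invisible to mean-zero functions.\<close>

lemma one_minus_chordal_kernel:
  "1 - chordal_kernel x y = (norm (x - y))\<^sup>2 / ((1 + (norm x)\<^sup>2) * (1 + (norm y)\<^sup>2))"
proof -
  have pos: "1 + (norm x)\<^sup>2 \<noteq> 0" "1 + (norm y)\<^sup>2 \<noteq> 0"
    by (simp_all add: add_nonneg_eq_0_iff)
  have sqrt2: "sqrt 2 * a * (sqrt 2 * b) = 2 * (a * b)" for a b
  proof -
    have "sqrt 2 * a * (sqrt 2 * b) = (sqrt 2 * sqrt 2) * (a * b)"
      by (simp only: mult_ac)
    then show ?thesis by simp
  qed
  have "chordal_kernel x y = (1 + (norm x)\<^sup>2 * (norm y)\<^sup>2 + 2 * (x $ 1 * y $ 1) + 2 * (x $ 2 * y $ 2))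
      / ((1 + (norm x)\<^sup>2) * (1 + (norm y)\<^sup>2))"
    by (simp add: chordal_kernel_def chordal_def eval_nat_numeral lessThan_Suc add_divide_distrib sqrt2)
  moreover have "(1 + (norm x)\<^sup>2) * (1 + (norm y)\<^sup>2)
      - (1 + (norm x)\<^sup>2 * (norm y)\<^sup>2 + 2 * (x $ 1 * y $ 1) + 2 * (x $ 2 * y $ 2)) = (norm (x - y))\<^sup>2"
    unfolding norm_vec2_sq by (simp add: power2_eq_square algebra_simps)
  moreover have "1 - N / P = (P - N) / P" if "P \<noteq> 0" for N P :: real
    using that by (simp add: diff_divide_distrib)
  ultimately show ?thesis
    using pos by simp
qed

lemma chordal_kernel_le_1: "chordal_kernel x y \<le> 1"
  using one_minus_chordal_kernel[of x y] by (smt (verit) divide_nonneg_nonneg mult_nonneg_nonneg zero_le_power2)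

text \<open>Nonnegativity lets the partial sums of the logarithmic series increase to their limit, so that the
limit itself dominates them.\<close>

lemma chordal_kernel_nonneg: "chordal_kernel x y \<ge> 0"
proof -
  have "norm (x - y) \<le> norm x + norm y"
    by (rule norm_triangle_ineq4)
  then have "(norm (x - y))\<^sup>2 \<le> (norm x + norm y)\<^sup>2"
    by (intro power_mono) auto
  also have "\<dots> \<le> (1 + (norm x)\<^sup>2) * (1 + (norm y)\<^sup>2)"
    using zero_le_power2[of "1 - norm x * norm y"]
    by (simp add: power2_eq_square algebra_simps)
  finally have "1 - chordal_kernel x y \<le> 1"
    unfolding one_minus_chordal_kernel by (intro divide_le_eq_1[THEN iffD2]) (simp add: add_pos_nonneg)
  then show ?thesis by simp
qed

lemma chordal_kernel_less_1: "x \<noteq> y \<Longrightarrow> chordal_kernel x y < 1"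
proof -
  assume "x \<noteq> y"
  then have "1 - chordal_kernel x y > 0"
    unfolding one_minus_chordal_kernel by (intro divide_pos_pos mult_pos_pos add_pos_nonneg) auto
  then show ?thesis by simp
qed

lemma abs_chordal_le: "i < 4 \<Longrightarrow> \<bar>chordal i x\<bar> \<le> 1"
proof -
  assume "i < 4"
  have "(chordal i x)\<^sup>2 \<le> (\<Sum>i<4. (chordal i x)\<^sup>2)"
    using \<open>i < 4\<close> by (intro member_le_sum) auto
  also have "\<dots> = chordal_kernel x x"
    by (simp add: chordal_kernel_def power2_eq_square)
  also have "\<dots> \<le> 1"
    by (rule chordal_kernel_le_1)
  finally show ?thesis
    by (simp add: abs_square_le_1)
qed

lemma borel_measurable_chordal [measurable]: "chordal i \<in> borel_measurable borel"
  unfolding chordal_def[abs_def] by measurable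

lemma neg_ln_series:
  assumes "0 \<le> s" "s < (1 :: real)"
  shows "(\<lambda>n. s ^ Suc n / real (Suc n)) sums (- ln (1 - s))"
proof -
  have "ln (1 - s) = (\<Sum>n. (-1) ^ n * (1 / real (n + 1)) * (1 - s - 1) ^ Suc n)"
    using assms by (intro ln_series) auto
  also have "(\<lambda>n. (-1) ^ n * (1 / real (n + 1)) * (1 - s - 1) ^ Suc n)
           = (\<lambda>n. - (s ^ Suc n / real (Suc n)))"
  proof
    fix n
    have m: "1 - s - 1 = - s" by simp
    have "(-1) ^ n * (-1) ^ Suc n = (-1 :: real)"
      by (simp flip: power_mult_distrib)
    moreover have "(-1) ^ n * (1 / real (n + 1)) * ((-1) ^ Suc n * s ^ Suc n)
        = ((-1) ^ n * (-1) ^ Suc n) * (s ^ Suc n / real (Suc n))"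
      by (simp add: mult_ac)
    ultimately show "(-1) ^ n * (1 / real (n + 1)) * (1 - s - 1) ^ Suc n = - (s ^ Suc n / real (Suc n))"
      unfolding m power_minus[of s "Suc n"] by simp
  qed
  finally have 1: "ln (1 - s) = (\<Sum>n. - (s ^ Suc n / real (Suc n)))" .
  have "summable (\<lambda>n. s ^ n)"
    using assms by (intro summable_geometric) auto
  then have "summable (\<lambda>n. s ^ Suc n / real (Suc n))"
  proof (rule summable_comparison_test')
    fix n :: nat
    have "s ^ Suc n / real (Suc n) \<le> s ^ n / 1"
      using assms by (intro frac_le) (auto intro: mult_left_le_one_le)
    then show "norm (s ^ Suc n / real (Suc n)) \<le> s ^ n"
      using assms by simp
  qed
  then show ?thesis
    using 1 by (simp add: suminf_minus sums_iff)
qed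

lemma (in finite_measure) integral_tensor:
  fixes u v :: "'a \<Rightarrow> real"
  assumes u: "integrable M u" and v: "integrable M v"
  shows "integrable (M \<Otimes>\<^sub>M M) (\<lambda>p. u (fst p) * v (snd p))"
    and "(LINT p|(M \<Otimes>\<^sub>M M). u (fst p) * v (snd p)) = (LINT x|M. u x) * (LINT x|M. v x)"
proof -
  interpret pair: pair_sigma_finite M M ..
  show int: "integrable (M \<Otimes>\<^sub>M M) (\<lambda>p. u (fst p) * v (snd p))"
  proof (rule pair.Fubini_integrable)
    show "AE x in M. integrable M (\<lambda>y. u (fst (x, y)) * v (snd (x, y)))"
      using v by simp
    show "integrable M (\<lambda>x. LINT y|M. norm (u (fst (x, y)) * v (snd (x, y))))"
      using u by (simp add: abs_mult)
  qed (use u v in simp)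
  then show "(LINT p|(M \<Otimes>\<^sub>M M). u (fst p) * v (snd p)) = (LINT x|M. u x) * (LINT x|M. v x)"
    by (subst pair.integral_fst'[symmetric]) simp_all
qed

text \<open>A sum of products \<open>\<phi> i x * \<phi> i y\<close> is a positive semidefinite kernel, and so are its powers: one factor
of the kernel is absorbed by replacing \<open>u\<close> with the functions \<open>\<phi> i * u\<close>. Power \<open>0\<close> gives the
square of the mean. The bound on the \<open>\<phi> i\<close> keeps everything integrable.\<close>

lemma (in finite_measure) integral_power_kernel_nonneg:
  fixes \<phi> :: "nat \<Rightarrow> 'a \<Rightarrow> real" and k :: nat
  defines "s \<equiv> \<lambda>x y. \<Sum>i<k. \<phi> i x * \<phi> i y"
  assumes [measurable]: "\<And>i. i < k \<Longrightarrow> \<phi> i \<in> borel_measurable M"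
    and bound: "\<And>i x. i < k \<Longrightarrow> \<bar>\<phi> i x\<bar> \<le> 1"
    and u: "integrable M u"
  shows "integrable (M \<Otimes>\<^sub>M M) (\<lambda>p. s (fst p) (snd p) ^ n * u (fst p) * u (snd p)) \<and>
         (LINT p|(M \<Otimes>\<^sub>M M). s (fst p) (snd p) ^ n * u (fst p) * u (snd p)) \<ge> 0"
  using u
proof (induction n arbitrary: u)
  case 0
  then show ?case
    using integral_tensor[OF 0 0] by (simp add: power2_eq_square)
next
  case (Suc n)
  have step: "integrable M (\<lambda>x. \<phi> i x * u x)" if i: "i < k" for i
  proof (rule Bochner_Integration.integrable_bound[OF Suc.prems])
    show "AE x in M. norm (\<phi> i x * u x) \<le> norm (u x)"
      using bound[OF i] by (auto intro!: AE_I2 mult_left_le_one_le simp: abs_mult)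
  qed (use i Suc.prems in simp)
  have eq: "s (fst p) (snd p) ^ Suc n * u (fst p) * u (snd p)
    = (\<Sum>i<k. s (fst p) (snd p) ^ n * (\<phi> i (fst p) * u (fst p)) * (\<phi> i (snd p) * u (snd p)))" for p
  proof -
    have "s (fst p) (snd p) ^ Suc n * u (fst p) * u (snd p)
      = (s (fst p) (snd p) ^ n * u (fst p) * u (snd p)) * (\<Sum>i<k. \<phi> i (fst p) * \<phi> i (snd p))"
      by (simp add: s_def mult_ac)
    then show ?thesis
      by (simp add: sum_distrib_left mult_ac)
  qed
  show ?case
    unfolding eq using Suc.IH[OF step]
    by (auto intro!: Bochner_Integration.integrable_sum sum_nonneg simp: Bochner_Integration.integral_sum)
qed

section \<open>Logarithmic potentials of radial weights\<close>

text \<open>The plane is identified with the complex numbers, because the averaging argument rests on the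
factorization \<open>a\<^sup>2 - b\<^sup>2 = (a - b) (a + b)\<close>.\<close>

definition cplx :: "real ^ 2 \<Rightarrow> complex" where
  "cplx v = Complex (v $ 1) (v $ 2)"

definition rot :: "complex \<Rightarrow> real ^ 2 \<Rightarrow> real ^ 2" where
  "rot \<zeta> v = (\<chi> i. if i = 1 then Re (\<zeta> * cplx v) else Im (\<zeta> * cplx v))"

lemma cplx_rotate: "cplx (rot \<zeta> v) = \<zeta> * cplx v"
  by (simp add: cplx_def rot_def complex_eq_iff)

lemma cplx_diff: "cplx (x - y) = cplx x - cplx y"
  by (simp add: cplx_def complex_eq_iff)

lemma norm_cplx: "norm (cplx v) = norm v"
  by (simp add: cplx_def cmod_def flip: norm_vec2_sq)

lemma norm_rotate: "norm \<zeta> = 1 \<Longrightarrow> norm (rot \<zeta> v) = norm v"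
  by (metis norm_cplx cplx_rotate norm_mult mult_1)

lemma linear_rotate: "linear (rot \<zeta>)"
  by (rule linearI) (auto simp: rot_def cplx_def vec_eq_iff algebra_simps)

lemma rotate_rotate: "rot \<zeta> (rot \<xi> v) = rot (\<zeta> * \<xi>) v"
  unfolding rot_def[of \<zeta> "rot \<xi> v"] rot_def[of "\<zeta> * \<xi>"] cplx_rotate mult.assoc ..

lemma rotate_1: "rot 1 v = v"
  using exhaust_2 by (auto simp: rot_def cplx_def vec_eq_iff)

lemma borel_measurable_cplx [measurable]: "cplx \<in> borel_measurable borel"
proof (rule borel_measurable_continuous_onI)
  have eq: "cplx = (\<lambda>v. of_real (v $ 1) + \<i> * of_real (v $ 2))"
    by (auto simp: cplx_def complex_eq_iff)
  show "continuous_on UNIV cplx"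
    unfolding eq by (intro continuous_intros)
qed

lemma borel_measurable_rotate [measurable]: "rot \<zeta> \<in> borel_measurable borel"
  by (intro borel_measurable_continuous_onI linear_continuous_on linear_linear[THEN iffD2] linear_rotate)

lemma lborel_distr_rotate:
  assumes "norm \<zeta> = 1"
  shows "distr lborel borel (rot \<zeta>) = lborel"
proof (rule lborel_eqI[symmetric])
  fix l u :: "real ^ 2"
  assume lu: "\<And>b. b \<in> Basis \<Longrightarrow> l \<bullet> b \<le> u \<bullet> b"
  have orth: "orthogonal_transformation (rot (inverse \<zeta>))"
    using assms by (simp add: orthogonal_transformation linear_rotate norm_rotate norm_inverse)
  have "\<zeta> \<noteq> 0"
    using assms by auto
  then have z: "\<zeta> * inverse \<zeta> = 1" "inverse \<zeta> * \<zeta> = 1"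
    by simp_all
  have img: "rot \<zeta> -` box l u = rot (inverse \<zeta>) ` box l u"
  proof
    show "rot \<zeta> -` box l u \<subseteq> rot (inverse \<zeta>) ` box l u"
    proof
      fix v assume "v \<in> rot \<zeta> -` box l u"
      then show "v \<in> rot (inverse \<zeta>) ` box l u"
        by (intro image_eqI[of _ _ "rot \<zeta> v"]) (auto simp: rotate_rotate z rotate_1)
    qed
  qed (auto simp: rotate_rotate z rotate_1)
  have "emeasure (distr lborel borel (rot \<zeta>)) (box l u) = emeasure lborel (rot \<zeta> -` box l u)"
    by (subst emeasure_distr) auto
  also have "\<dots> = emeasure lebesgue (rot (inverse \<zeta>) ` box l u)"
  proof -
    have "rot \<zeta> -` box l u \<in> sets lborel"
      using measurable_sets[OF borel_measurable_rotate, of "box l u" \<zeta>] by simp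
    then show ?thesis by (simp add: img)
  qed
  also have "\<dots> = measure lebesgue (rot (inverse \<zeta>) ` box l u)"
    using measurable_orthogonal_image[OF orth lmeasurable_box[of l u]]
    by (simp add: emeasure_eq_measure2)
  also have "\<dots> = measure lebesgue (box l u)"
    using measure_orthogonal_image[OF orth lmeasurable_box[of l u]] by simp
  also have "\<dots> = (\<Prod>b\<in>Basis. (u - l) \<bullet> b)"
    using lu by (simp add: measure_lborel_box_eq inner_diff_left)
  finally show "emeasure (distr lborel borel (rot \<zeta>)) (box l u) = (\<Prod>b\<in>Basis. (u - l) \<bullet> b)" .
qed simp

lemma
  fixes f :: "real ^ 2 \<Rightarrow> real"
  assumes \<zeta>: "norm \<zeta> = 1" and f[measurable]: "f \<in> borel_measurable borel"
  shows integral_rotate: "(LINT y|lborel. f (rot \<zeta> y)) = (LINT y|lborel. f y)"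
    and integrable_rotate: "integrable lborel f \<Longrightarrow> integrable lborel (\<lambda>y. f (rot \<zeta> y))"
proof -
  have "(LINT y|distr lborel borel (rot \<zeta>). f y) = (LINT y|lborel. f (rot \<zeta> y))"
    by (rule integral_distr) auto
  then show "(LINT y|lborel. f (rot \<zeta> y)) = (LINT y|lborel. f y)"
    by (simp add: lborel_distr_rotate[OF \<zeta>])
  have "integrable (distr lborel borel (rot \<zeta>)) f \<longleftrightarrow> integrable lborel (\<lambda>y. f (rot \<zeta> y))"
    by (rule integrable_distr_eq) auto
  then show "integrable lborel f \<Longrightarrow> integrable lborel (\<lambda>y. f (rot \<zeta> y))"
    by (simp add: lborel_distr_rotate[OF \<zeta>])
qed

text \<open>The mean of \<open>ln (norm (x - y))\<close> over the rotations of \<open>y\<close> by the \<open>2 ^ n\<close>-th roots of unity,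
written in closed form.\<close>

definition ln_dist_pow :: "real ^ 2 \<Rightarrow> nat \<Rightarrow> real ^ 2 \<Rightarrow> real" where
  "ln_dist_pow x n y = ln (cmod (cplx x ^ (2 ^ n) - cplx y ^ (2 ^ n))) / 2 ^ n"

lemma borel_measurable_ln_dist_pow [measurable]: "ln_dist_pow x n \<in> borel_measurable borel"
  unfolding ln_dist_pow_def[abs_def] by measurable

lemma ln_dist_pow_0: "ln_dist_pow x 0 y = ln (norm (x - y))"
  by (simp add: ln_dist_pow_def norm_cplx flip: cplx_diff)

text \<open>Doubling the number of rotations averages the old mean with its rotation by a solution \<open>\<zeta>\<close> of
\<open>\<zeta> ^ (2 ^ n) = - 1\<close>. Points with \<open>norm y = norm x\<close> are excluded, since there a factor may vanish.\<close>

lemma ln_dist_pow_Suc: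
  assumes \<zeta>: "\<zeta> ^ (2 ^ n) = -1" and ne: "norm y \<noteq> norm x"
  shows "ln_dist_pow x (Suc n) y = (ln_dist_pow x n y + ln_dist_pow x n (rot \<zeta> y)) / 2"
proof -
  let ?a = "cplx x ^ (2 ^ n)" and ?b = "cplx y ^ (2 ^ n)"
  have "cmod ?a \<noteq> cmod ?b"
    using ne by (simp add: norm_power norm_cplx power_eq_iff_eq_base)
  then have "?a - ?b \<noteq> 0" "?a + ?b \<noteq> 0"
    by (auto simp: add_eq_0_iff2)
  then have "ln (cmod ((?a - ?b) * (?a + ?b))) = ln (cmod (?a - ?b)) + ln (cmod (?a + ?b))"
    unfolding norm_mult by (intro ln_mult_pos) auto
  moreover have "(?a - ?b) * (?a + ?b) = cplx x ^ (2 ^ Suc n) - cplx y ^ (2 ^ Suc n)"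
  proof -
    have "z ^ (2 ^ Suc n) = z ^ (2 ^ n) * z ^ (2 ^ n)" for z :: complex
      by (simp add: mult_2 power_add)
    then show ?thesis by (simp add: algebra_simps)
  qed
  moreover have "cplx (rot \<zeta> y) ^ (2 ^ n) = - ?b"
    by (simp add: cplx_rotate power_mult_distrib \<zeta>)
  ultimately show ?thesis
    by (simp add: ln_dist_pow_def field_simps)
qed

text \<open>Averaging over rotations does not change the integral against a radial weight. The weight vanishes
on the circle through \<open>x\<close>, where the recursion for the means breaks down.\<close>

lemma integral_ln_dist_pow:
  fixes F :: "real \<Rightarrow> real" and x :: "real ^ 2"
  assumes [measurable]: "F \<in> borel_measurable borel"
    and F0: "F (norm x) = 0"
    and int: "integrable lborel (\<lambda>y. ln (norm (x - y)) * F (norm y))"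
  shows "integrable lborel (\<lambda>y. ln_dist_pow x n y * F (norm y)) \<and>
         (LINT y|lborel. ln_dist_pow x n y * F (norm y)) = (LINT y|lborel. ln (norm (x - y)) * F (norm y))"
proof (induction n)
  case 0
  show ?case using int by (simp add: ln_dist_pow_0)
next
  case (Suc n)
  define \<zeta> where "\<zeta> = cis (pi / 2 ^ n)"
  have "\<zeta> ^ (2 ^ n) = cis (real (2 ^ n) * (pi / 2 ^ n))"
    by (simp only: \<zeta>_def Complex.DeMoivre)
  then have \<zeta>: "norm \<zeta> = 1" "\<zeta> ^ (2 ^ n) = -1"
    by (simp_all add: \<zeta>_def)
  let ?f = "\<lambda>y. ln_dist_pow x n y * F (norm y)"
  have eq: "ln_dist_pow x (Suc n) y * F (norm y) = (?f y + ?f (rot \<zeta> y)) / 2" for y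
    using ln_dist_pow_Suc[OF \<zeta>(2), of y x] F0
    by (cases "norm y = norm x") (simp_all add: norm_rotate \<zeta> algebra_simps)
  have "integrable lborel (\<lambda>y. ?f (rot \<zeta> y))" "(LINT y|lborel. ?f (rot \<zeta> y)) = (LINT y|lborel. ?f y)"
    using Suc integrable_rotate[OF \<zeta>(1), of ?f] integral_rotate[OF \<zeta>(1), of ?f] by simp_all
  then show ?case
    unfolding eq using Suc by simp
qed

text \<open>With \<open>a > b\<close> the two norms and \<open>N = 2 ^ n\<close>, the distance of the \<open>N\<close>-th powers lies between
\<open>a ^ N (1 - b / a)\<close> and \<open>2 a ^ N\<close>. After taking \<open>N\<close>-th roots both bounds tend to \<open>a\<close>, uniformly away
from the circle \<open>a = b\<close>.\<close>

lemma ln_dist_pow_near_ln_max: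
  fixes x y :: "real ^ 2"
  assumes \<epsilon>: "0 < \<epsilon>" "\<epsilon> \<le> \<bar>norm y - norm x\<bar>" and B: "norm x \<le> B" "norm y \<le> B"
  shows "\<bar>ln_dist_pow x n y - ln (max (norm x) (norm y))\<bar> \<le> (ln 2 + \<bar>ln (\<epsilon> / B)\<bar>) / 2 ^ n"
proof -
  define N :: nat where "N = 2 ^ n"
  have N: "N \<ge> 1" by (simp add: N_def)
  define a b where "a = max (norm x) (norm y)" and "b = min (norm x) (norm y)"
  have ab: "0 \<le> b" "b < a" "a \<le> B" "a > 0" "\<epsilon> \<le> a - b"
    using assms norm_ge_zero[of x] norm_ge_zero[of y] unfolding a_def b_def by linarith+
  define d where "d = cmod (cplx x ^ N - cplx y ^ N)"
  have "d \<le> cmod (cplx x ^ N) + cmod (cplx y ^ N)"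
    unfolding d_def by (rule norm_triangle_ineq4)
  also have "\<dots> = a ^ N + b ^ N"
    by (simp add: norm_power norm_cplx a_def b_def max_def min_def)
  also have "\<dots> \<le> 2 * a ^ N"
    using ab by (simp add: power_mono)
  finally have upper: "d \<le> 2 * a ^ N" .
  have "a ^ N * (\<epsilon> / B) \<le> a ^ N * (1 - b / a)"
  proof (rule mult_left_mono)
    have "\<epsilon> / B \<le> (a - b) / a"
      using ab \<epsilon> by (intro frac_le) auto
    then show "\<epsilon> / B \<le> 1 - b / a"
      using ab by (simp add: diff_divide_distrib)
  qed (use ab in simp)
  also have "\<dots> = a ^ N - a ^ (N - 1) * b"
    using ab N by (simp add: right_diff_distrib power_diff)
  also have "\<dots> \<le> a ^ N - b ^ N"
  proof -
    have "b ^ (N - 1) * b \<le> a ^ (N - 1) * b"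
      using ab by (intro mult_right_mono power_mono) auto
    then show ?thesis using N by (simp flip: power_Suc2)
  qed
  also have "\<dots> \<le> \<bar>cmod (cplx x ^ N) - cmod (cplx y ^ N)\<bar>"
    by (auto simp: norm_power norm_cplx a_def b_def max_def min_def)
  also have "\<dots> \<le> d"
    unfolding d_def by (rule norm_triangle_ineq3)
  finally have lower: "a ^ N * (\<epsilon> / B) \<le> d" .
  have pos: "a ^ N > 0" "\<epsilon> / B > 0"
    using ab \<epsilon> by auto
  then have "d > 0"
    using lower by (meson less_le_trans mult_pos_pos)
  then have "ln d \<le> ln (2 * a ^ N)" "ln (a ^ N * (\<epsilon> / B)) \<le> ln d"
    using upper lower mult_pos_pos[OF pos] by (intro ln_mono; simp)+
  moreover have "ln (2 * a ^ N) = ln 2 + N * ln a" "ln (a ^ N * (\<epsilon> / B)) = N * ln a + ln (\<epsilon> / B)"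
    using pos ab by (simp_all only: ln_mult_pos ln_realpow zero_less_numeral)
  ultimately have "ln d \<le> ln 2 + N * ln a" "N * ln a + ln (\<epsilon> / B) \<le> ln d"
    by simp_all
  then have "\<bar>ln d - N * ln a\<bar> \<le> ln 2 + \<bar>ln (\<epsilon> / B)\<bar>"
    using ln_ge_zero[of "2 :: real"] by linarith
  then have "\<bar>ln d - N * ln a\<bar> / N \<le> (ln 2 + \<bar>ln (\<epsilon> / B)\<bar>) / N"
    by (rule divide_right_mono) simp
  moreover have "\<bar>ln d - N * ln a\<bar> / N = \<bar>ln d / N - ln a\<bar>"
  proof -
    have "ln d / N - ln a = (ln d - N * ln a) / N"
      using N by (simp add: field_simps)
    then show ?thesis by simp
  qed
  ultimately show ?thesis
    by (simp add: ln_dist_pow_def d_def N_def a_def)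
qed

text \<open>The left-hand side equals the integral of every mean \<open>ln_dist_pow x n\<close>, and these converge uniformly on
the support of the weight.\<close>

lemma integral_ln_dist_off_annulus:
  fixes F :: "real \<Rightarrow> real" and x :: "real ^ 2"
  assumes [measurable]: "F \<in> borel_measurable borel"
    and \<epsilon>: "\<epsilon> > 0" and B: "norm x \<le> B"
    and F0: "\<And>r. \<bar>r - norm x\<bar> < \<epsilon> \<or> r > B \<Longrightarrow> F r = 0"
    and intF: "integrable lborel (\<lambda>y :: real ^ 2. F (norm y))"
    and int: "integrable lborel (\<lambda>y. ln (norm (x - y)) * F (norm y))"
    and int': "integrable lborel (\<lambda>y :: real ^ 2. ln (max (norm x) (norm y)) * F (norm y))"
  shows "(LINT y|lborel. ln (norm (x - y)) * F (norm y)) = (LINT y :: real ^ 2|lborel. ln (max (norm x) (norm y)) * F (norm y))"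
    (is "?I = ?J")
proof -
  define C where "C = ln 2 + \<bar>ln (\<epsilon> / B)\<bar>"
  have Fx: "F (norm x) = 0"
    using F0 \<epsilon> by simp
  have bound: "\<bar>?I - ?J\<bar> \<le> C / 2 ^ n * (LINT y :: real ^ 2|lborel. \<bar>F (norm y)\<bar>)" for n
  proof -
    note h = integral_ln_dist_pow[where F = F and x = x and n = n, OF assms(1) Fx int]
    have "?I - ?J = (LINT y|lborel. ln_dist_pow x n y * F (norm y) - ln (max (norm x) (norm y)) * F (norm y))"
      using h int' by simp
    also have "\<bar>\<dots>\<bar> \<le> (LINT y :: real ^ 2|lborel. C / 2 ^ n * \<bar>F (norm y)\<bar>)"
    proof (rule order_trans[OF integral_abs_bound integral_mono])
      show "integrable lborel (\<lambda>y. \<bar>ln_dist_pow x n y * F (norm y) - ln (max (norm x) (norm y)) * F (norm y)\<bar>)"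
        using h int' by simp
      show "integrable lborel (\<lambda>y :: real ^ 2. C / 2 ^ n * \<bar>F (norm y)\<bar>)"
        using intF by simp
      fix y
      show "\<bar>ln_dist_pow x n y * F (norm y) - ln (max (norm x) (norm y)) * F (norm y)\<bar> \<le> C / 2 ^ n * \<bar>F (norm y)\<bar>"
      proof (cases "\<bar>norm y - norm x\<bar> < \<epsilon> \<or> norm y > B")
        case True
        then show ?thesis using F0 by simp
      next
        case False
        then have "\<bar>ln_dist_pow x n y - ln (max (norm x) (norm y))\<bar> \<le> C / 2 ^ n"
          unfolding C_def using \<epsilon> B by (intro ln_dist_pow_near_ln_max) auto
        then show ?thesis
          unfolding left_diff_distrib[symmetric] abs_mult by (rule mult_right_mono) simp
      qed
    qed
    finally show ?thesis by simp
  qed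
  have "(\<lambda>n. C * (LINT y :: real ^ 2|lborel. \<bar>F (norm y)\<bar>) * (1 / 2) ^ n) \<longlonglongrightarrow> C * (LINT y :: real ^ 2|lborel. \<bar>F (norm y)\<bar>) * 0"
    by (intro tendsto_mult tendsto_const LIMSEQ_realpow_zero) auto
  then have "\<bar>?I - ?J\<bar> \<le> 0"
    using bound by (intro LIMSEQ_le_const[where X = "\<lambda>n. C * (LINT y :: real ^ 2|lborel. \<bar>F (norm y)\<bar>) * (1 / 2) ^ n"])
      (auto simp: power_divide)
  then show ?thesis by simp
qed

text \<open>Newton's theorem in the plane: a radial charge acts on \<open>x\<close> as if each of its circles inside
\<open>norm x\<close> were concentrated at the origin, and each circle outside had constant potential. It follows
from the previous lemma by letting the removed annulus shrink to a null circle.\<close>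

lemma integral_ln_dist_radial:
  fixes F :: "real \<Rightarrow> real" and x :: "real ^ 2"
  assumes [measurable]: "F \<in> borel_measurable borel"
    and B: "norm x \<le> B"
    and F0: "\<And>r. r > B \<Longrightarrow> F r = 0"
    and intF: "integrable lborel (\<lambda>y :: real ^ 2. F (norm y))"
    and int: "integrable lborel (\<lambda>y. ln (norm (x - y)) * F (norm y))"
    and int': "integrable lborel (\<lambda>y :: real ^ 2. ln (max (norm x) (norm y)) * F (norm y))"
  shows "(LINT y|lborel. ln (norm (x - y)) * F (norm y)) = (LINT y :: real ^ 2|lborel. ln (max (norm x) (norm y)) * F (norm y))"
proof -
  define F' where "F' m r = (if \<bar>r - norm x\<bar> < 1 / real (Suc m) then 0 else F r)" for m r
  have [measurable]: "F' m \<in> borel_measurable borel" for m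
    unfolding F'_def by measurable
  have le: "\<bar>F' m r\<bar> \<le> \<bar>F r\<bar>" for m r
    by (simp add: F'_def)
  have int_F': "integrable lborel (\<lambda>y. g y * F' m (norm y))"
    if "integrable lborel (\<lambda>y. g y * F (norm y))" and [measurable]: "g \<in> borel_measurable borel"
    for g :: "real ^ 2 \<Rightarrow> real" and m
    using that(1) by (rule Bochner_Integration.integrable_bound)
      (auto simp: abs_mult le mult_left_mono)
  have eq: "(LINT y|lborel. ln (norm (x - y)) * F' m (norm y)) = (LINT y :: real ^ 2|lborel. ln (max (norm x) (norm y)) * F' m (norm y))" for m
  proof (rule integral_ln_dist_off_annulus[where \<epsilon> = "1 / real (Suc m)" and B = B])
    show "integrable lborel (\<lambda>y :: real ^ 2. F' m (norm y))"
      using int_F'[of "\<lambda>_. 1" m] intF by simp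
    show "integrable lborel (\<lambda>y. ln (norm (x - y)) * F' m (norm y))"
      by (rule int_F'[OF int]) measurable
    show "integrable lborel (\<lambda>y :: real ^ 2. ln (max (norm x) (norm y)) * F' m (norm y))"
      by (rule int_F'[OF int']) measurable
  qed (use B F0 in \<open>auto simp: F'_def\<close>)
  have sphere: "AE y :: real ^ 2 in lborel. norm y \<noteq> norm x"
  proof -
    have "sphere (0 :: real ^ 2) (norm x) \<in> null_sets lborel"
      using negligible_sphere[of "0 :: real ^ 2" "norm x"]
      by (simp add: negligible_iff_null_sets null_sets_completion_iff)
    then have "AE y :: real ^ 2 in lborel. y \<notin> sphere 0 (norm x)"
      by (rule AE_not_in)
    then show ?thesis by simp
  qed
  have lim: "(\<lambda>m. LINT y|lborel. g y * F' m (norm y)) \<longlonglongrightarrow> (LINT y|lborel. g y * F (norm y))"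
    if "integrable lborel (\<lambda>y. g y * F (norm y))" and [measurable]: "g \<in> borel_measurable borel"
    for g :: "real ^ 2 \<Rightarrow> real"
  proof (rule integral_dominated_convergence)
    show "integrable lborel (\<lambda>y. \<bar>g y * F (norm y)\<bar>)"
      using that(1) by simp
    show "AE y in lborel. norm (g y * F' m (norm y)) \<le> \<bar>g y * F (norm y)\<bar>" for m
      by (auto simp: abs_mult le mult_left_mono)
    show "AE y in lborel. (\<lambda>m. g y * F' m (norm y)) \<longlonglongrightarrow> g y * F (norm y)"
      using sphere
    proof eventually_elim
      fix y :: "real ^ 2" assume "norm y \<noteq> norm x"
      then have pos: "\<bar>norm y - norm x\<bar> > 0" by simp
      have "eventually (\<lambda>m. 1 / real (Suc m) < \<bar>norm y - norm x\<bar>) sequentially"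
        using order_tendstoD(2)[OF LIMSEQ_inverse_real_of_nat pos] by (simp add: inverse_eq_divide)
      then have "eventually (\<lambda>m. g y * F' m (norm y) = g y * F (norm y)) sequentially"
        by eventually_elim (simp add: F'_def)
      then show "(\<lambda>m. g y * F' m (norm y)) \<longlonglongrightarrow> g y * F (norm y)"
        by (rule tendsto_eventually)
    qed
  qed simp_all
  show ?thesis
    using lim[OF int] lim[OF int'] unfolding eq by (intro LIMSEQ_unique) auto
qed

section \<open>Radial integrals by layers\<close>

lemma emeasure_disc: "0 \<le> r \<Longrightarrow> emeasure lborel (ball (c :: real ^ 2) r) = ennreal (pi * r\<^sup>2)"
  by (simp add: emeasure_ball unit_ball_vol_2)

lemma borel_ball [measurable]: "ball c r \<in> sets borel"
  by simp

text \<open>Integration by parts in the radius, which replaces polar coordinates: writing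
\<open>G S - G r\<close> as the integral of \<open>g\<close> over \<open>{r..S}\<close> and exchanging integrals leaves only the masses
\<open>W t\<close> of the discs of radius \<open>t\<close>. The antiderivative \<open>H\<close> of \<open>g * W\<close> is a parameter, so that the
remaining one-dimensional integral is evaluated at once.\<close>

lemma radial_layer_cake:
  fixes w :: "real ^ 2 \<Rightarrow> real" and G g H W :: "real \<Rightarrow> real"
  assumes a: "0 \<le> a" "a \<le> S"
    and [measurable]: "w \<in> borel_measurable borel" "G \<in> borel_measurable borel"
      "g \<in> borel_measurable borel" "W \<in> borel_measurable borel"
    and w_nonneg: "\<And>y. w y \<ge> 0"
    and w_int: "integrable lborel (\<lambda>y. indicator (ball 0 S) y * w y)"
    and W: "\<And>t. a \<le> t \<Longrightarrow> t \<le> S \<Longrightarrow> (LINT y|lborel. indicator (ball 0 t) y * w y) = W t"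
    and G: "\<And>t. a \<le> t \<Longrightarrow> t \<le> S \<Longrightarrow> (G has_real_derivative g t) (at t)"
    and g_nonneg: "\<And>t. a \<le> t \<Longrightarrow> t \<le> S \<Longrightarrow> g t \<ge> 0"
    and H: "\<And>t. a \<le> t \<Longrightarrow> t \<le> S \<Longrightarrow> (H has_real_derivative g t * W t) (at t)"
  shows "has_bochner_integral lborel (\<lambda>y. G (max a (norm y)) * (indicator (ball 0 S) y * w y))
           (G S * W S - (H S - H a))"
proof -
  have G_mono: "G r \<le> G S" if "a \<le> r" "r \<le> S" for r
    using that by (intro DERIV_nonneg_imp_nondecreasing[of r S G]) (use G g_nonneg order_trans in blast)+
  have W_nonneg: "W t \<ge> 0" if "a \<le> t" "t \<le> S" for t
    unfolding W[OF that, symmetric] using w_nonneg by (intro Bochner_Integration.integral_nonneg) simp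
  have H_mono: "H a \<le> H S"
    using a by (intro DERIV_nonneg_imp_nondecreasing[of a S H])
      (use H g_nonneg W_nonneg mult_nonneg_nonneg in blast)+
  have W_nn: "(\<integral>\<^sup>+ y. ennreal (indicator (ball 0 t) y * w y) \<partial>lborel) = ennreal (W t)"
    if "a \<le> t" "t \<le> S" for t
  proof (subst nn_integral_eq_integral)
    show "integrable lborel (\<lambda>y. indicator (ball 0 t) y * w y)"
    proof (rule Bochner_Integration.integrable_bound[OF w_int])
      show "AE y in lborel. norm (indicator (ball 0 t) y * w y) \<le> norm (indicator (ball 0 S) y * w y)"
        using that w_nonneg by (auto simp: indicator_def)
      show "(\<lambda>y. indicator (ball 0 t) y * w y) \<in> borel_measurable lborel" by measurable
    qed
  qed (use w_nonneg W that in auto)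
  define D where "D y = (G S - G (max a (norm y))) * (indicator (ball 0 S) y * w y)" for y
  have [measurable]: "D \<in> borel_measurable borel"
    unfolding D_def by measurable
  have D_nonneg: "D y \<ge> 0" for y
    unfolding D_def using G_mono[of "max a (norm y)"] a w_nonneg[of y]
    by (cases "y \<in> ball 0 S") (auto intro!: mult_nonneg_nonneg)
  have "(\<integral>\<^sup>+ y. ennreal (D y) \<partial>lborel)
      = (\<integral>\<^sup>+ y. \<integral>\<^sup>+ t. ennreal (g t) * indicator {a..S} t * ennreal (indicator (ball 0 t) y * w y) \<partial>lborel \<partial>lborel)"
  proof (rule nn_integral_cong)
    fix y :: "real ^ 2"
    define m where "m = max a (norm y)"
    show "ennreal (D y) = (\<integral>\<^sup>+ t. ennreal (g t) * indicator {a..S} t * ennreal (indicator (ball 0 t) y * w y) \<partial>lborel)"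
    proof (cases "norm y < S")
      case True
      then have m: "a \<le> m" "m \<le> S"
        using a by (auto simp: m_def)
      have "(\<integral>\<^sup>+ t. ennreal (g t) * indicator {a..S} t * ennreal (indicator (ball 0 t) y * w y) \<partial>lborel)
          = (\<integral>\<^sup>+ t. ennreal (g t) * indicator {m..S} t * ennreal (w y) \<partial>lborel)"
        using AE_lborel_singleton[of "norm y"]
        by (intro nn_integral_cong_AE, eventually_elim) (auto simp: indicator_def m_def)
      also have "\<dots> = (\<integral>\<^sup>+ t. ennreal (g t) * indicator {m..S} t \<partial>lborel) * ennreal (w y)"
        by (rule nn_integral_multc) measurable
      also have "(\<integral>\<^sup>+ t. ennreal (g t) * indicator {m..S} t \<partial>lborel) = ennreal (G S - G m)"
        using m by (intro nn_integral_FTC_Icc) (auto intro!: G g_nonneg)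
      also have "ennreal (G S - G m) * ennreal (w y) = ennreal (D y)"
        using True G_mono[OF m] w_nonneg by (simp add: D_def m_def ennreal_mult)
      finally show ?thesis by simp
    next
      case False
      have "(\<integral>\<^sup>+ t. ennreal (g t) * indicator {a..S} t * ennreal (indicator (ball 0 t) y * w y) \<partial>lborel)
          = (\<integral>\<^sup>+ (t :: real). 0 \<partial>lborel)"
        using False by (intro nn_integral_cong) (auto simp: indicator_def)
      then show ?thesis using False by (simp add: D_def)
    qed
  qed
  also have "\<dots> = (\<integral>\<^sup>+ t. \<integral>\<^sup>+ y. ennreal (g t) * indicator {a..S} t * ennreal (indicator (ball 0 t) y * w y) \<partial>lborel \<partial>lborel)"
  proof (rule lborel_pair.Fubini')
    have "(\<lambda>(t, y :: real ^ 2). indicator {p :: real \<times> (real ^ 2). norm (snd p) < fst p} (t, y) :: real)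
        \<in> borel_measurable (lborel \<Otimes>\<^sub>M lborel)"
      by measurable
    then have [measurable]: "(\<lambda>(t, y :: real ^ 2). indicator (ball 0 t) y :: real) \<in> borel_measurable (lborel \<Otimes>\<^sub>M lborel)"
      by (rule measurable_cong[THEN iffD1, rotated]) (auto simp: indicator_def)
    show "(\<lambda>(t, y). ennreal (g t) * indicator {a..S} t * ennreal (indicator (ball 0 t) y * w y)) \<in> borel_measurable (lborel \<Otimes>\<^sub>M lborel)"
      by measurable
  qed
  also have "\<dots> = (\<integral>\<^sup>+ t. ennreal (g t * W t) * indicator {a..S} t \<partial>lborel)"
  proof (rule nn_integral_cong)
    fix t :: real
    have "(\<integral>\<^sup>+ y. ennreal (g t) * indicator {a..S} t * ennreal (indicator (ball 0 t) y * w y) \<partial>lborel)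
       = ennreal (g t) * indicator {a..S} t * (\<integral>\<^sup>+ y. ennreal (indicator (ball 0 t) y * w y) \<partial>lborel)"
      by (rule nn_integral_cmult) measurable
    also have "\<dots> = ennreal (g t * W t) * indicator {a..S} t"
      using g_nonneg[of t] W_nonneg[of t] W_nn[of t]
      by (cases "t \<in> {a..S}") (auto simp: ennreal_mult)
    finally show "(\<integral>\<^sup>+ y. ennreal (g t) * indicator {a..S} t * ennreal (indicator (ball 0 t) y * w y) \<partial>lborel)
      = ennreal (g t * W t) * indicator {a..S} t" .
  qed
  also have "\<dots> = ennreal (H S - H a)"
    using a by (intro nn_integral_FTC_Icc) (auto intro!: H mult_nonneg_nonneg g_nonneg W_nonneg)
  finally have nn: "(\<integral>\<^sup>+ y. ennreal (D y) \<partial>lborel) = ennreal (H S - H a)" .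
  have D: "has_bochner_integral lborel D (H S - H a)"
    using D_nonneg H_mono nn by (intro has_bochner_integral_nn_integral) auto
  have "has_bochner_integral lborel (\<lambda>y. indicator (ball 0 S) y * w y) (W S)"
    using w_int W[of S] a by (simp add: has_bochner_integral_iff)
  from has_bochner_integral_diff[OF has_bochner_integral_mult_right[OF this, of "G S"] D]
  show ?thesis
    by (simp add: D_def algebra_simps)
qed

text \<open>The same exchange of integrals shows that the logarithmic singularity has finite mass, with a bound
that does not depend on \<open>x\<close>. Only an inequality holds pointwise: at \<open>y = x\<close> the left integrand is
\<open>ln (1 / 0) = 0\<close> while the inner integral on the right diverges.\<close>

lemma nn_integral_ln_singularity:
  "(\<integral>\<^sup>+ y. ennreal (if norm (x - y) < 1 then ln (1 / norm (x - y)) else 0) \<partial>lborel) \<le> ennreal (pi / 2)"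
  for x :: "real ^ 2"
proof -
  have "(\<integral>\<^sup>+ y. ennreal (if norm (x - y) < 1 then ln (1 / norm (x - y)) else 0) \<partial>lborel)
     \<le> (\<integral>\<^sup>+ y. \<integral>\<^sup>+ t. ennreal (1 / t) * indicator {0..1} t * indicator (ball x t) y \<partial>lborel \<partial>lborel)"
  proof (rule nn_integral_mono)
    fix y :: "real ^ 2"
    define r where "r = norm (x - y)"
    show "ennreal (if norm (x - y) < 1 then ln (1 / norm (x - y)) else 0)
       \<le> (\<integral>\<^sup>+ t. ennreal (1 / t) * indicator {0..1} t * indicator (ball x t) y \<partial>lborel)"
    proof (cases "0 < r \<and> r < 1")
      case True
      have "(\<integral>\<^sup>+ t. ennreal (1 / t) * indicator {0..1} t * indicator (ball x t) y \<partial>lborel)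
          = (\<integral>\<^sup>+ t. ennreal (1 / t) * indicator {r..1} t \<partial>lborel)"
        using AE_lborel_singleton[of r]
        by (intro nn_integral_cong_AE, eventually_elim)
          (use True in \<open>auto simp: indicator_def r_def dist_norm dest: order_trans[OF norm_ge_zero]\<close>)
      also have "\<dots> = ennreal (ln 1 - ln r)"
        using True by (intro nn_integral_FTC_Icc) (auto intro!: derivative_eq_intros)
      finally show ?thesis
        using True by (simp add: r_def ln_div)
    next
      case False
      then show ?thesis by (auto simp: r_def)
    qed
  qed
  also have "\<dots> = (\<integral>\<^sup>+ t. \<integral>\<^sup>+ y. ennreal (1 / t) * indicator {0..1} t * indicator (ball x t) y \<partial>lborel \<partial>lborel)"
  proof (rule lborel_pair.Fubini')
    have "(\<lambda>(t, y :: real ^ 2). indicator {p :: real \<times> (real ^ 2). norm (x - snd p) < fst p} (t, y) :: ennreal)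
        \<in> borel_measurable (lborel \<Otimes>\<^sub>M lborel)"
      by measurable
    then have [measurable]: "(\<lambda>(t, y). indicator (ball x t) y :: ennreal) \<in> borel_measurable (lborel \<Otimes>\<^sub>M lborel)"
      by (rule measurable_cong[THEN iffD1, rotated]) (auto simp: indicator_def dist_norm)
    show "(\<lambda>(t, y). ennreal (1 / t) * indicator {0..1} t * indicator (ball x t) y) \<in> borel_measurable (lborel \<Otimes>\<^sub>M lborel)"
      by measurable
  qed
  also have "\<dots> = (\<integral>\<^sup>+ t. ennreal (pi * t) * indicator {0..1} t \<partial>lborel)"
  proof (rule nn_integral_cong)
    fix t :: real
    have "(\<integral>\<^sup>+ y. ennreal (1 / t) * indicator {0..1} t * indicator (ball x t) y \<partial>lborel)
       = ennreal (1 / t) * indicator {0..1} t * (\<integral>\<^sup>+ y. indicator (ball x t) y \<partial>lborel)"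
      by (rule nn_integral_cmult) measurable
    also have "\<dots> = ennreal (pi * t) * indicator {0..1} t"
      by (cases "t \<in> {0..1}")
        (auto simp: emeasure_disc power2_eq_square simp flip: ennreal_mult split: split_indicator)
    finally show "(\<integral>\<^sup>+ y. ennreal (1 / t) * indicator {0..1} t * indicator (ball x t) y \<partial>lborel)
       = ennreal (pi * t) * indicator {0..1} t" .
  qed
  also have "\<dots> = ennreal (pi * 1\<^sup>2 / 2 - pi * 0\<^sup>2 / 2)"
    by (intro nn_integral_FTC_Icc) (auto intro!: derivative_eq_intros)
  finally show ?thesis by simp
qed

section \<open>The modified Bessel function and the root equation\<close>

lemma summable_bessel: "summable (\<lambda>m. z ^ m / (fact m)\<^sup>2)" for z :: real
proof (rule summable_comparison_test')
  show "summable (\<lambda>m. inverse (fact m) * \<bar>z\<bar> ^ m)"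
    by (rule summable_exp)
  fix m :: nat
  have "1 * (fact m :: real) \<le> (fact m)\<^sup>2"
    unfolding power2_eq_square by (intro mult_right_mono) (auto simp: fact_ge_1)
  then have "\<bar>z\<bar> ^ m / (fact m)\<^sup>2 \<le> \<bar>z\<bar> ^ m / fact m"
    by (intro divide_left_mono) auto
  then show "norm (z ^ m / (fact m)\<^sup>2) \<le> inverse (fact m) * \<bar>z\<bar> ^ m"
    by (simp add: power_abs divide_inverse mult.commute abs_mult)
qed

text \<open>Substituting \<open>z = x\<^sup>2 / 4\<close> turns the series of \<open>I\<^sub>0\<close> into a power series without gaps, to which termwise
differentiation applies directly.\<close>

definition bessel_J :: "real \<Rightarrow> real" where
  "bessel_J z = (\<Sum>m. 1 / (fact m)\<^sup>2 * z ^ m)"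

lemma bessel_I0_eq: "bessel_I0 x = bessel_J (x\<^sup>2 / 4)"
  unfolding bessel_I0_def bessel_J_def
  by (simp add: power_mult power_divide mult.commute[of "(fact _)\<^sup>2"])

lemma bessel_J_derivs:
  obtains J' J'' where "\<And>z. (bessel_J has_real_derivative J' z) (at z)"
    and "\<And>z. (J' has_real_derivative J'' z) (at z)"
    and "\<And>z. z * J'' z + J' z = bessel_J z"
    and "\<And>z. z \<ge> 0 \<Longrightarrow> J' z \<ge> 0" 
    and "bessel_J 0 = 1"
proof
  let ?c = "\<lambda>m. 1 / (fact m :: real)\<^sup>2"
  let ?J' = "\<lambda>z. \<Sum>m. diffs ?c m * z ^ m"
  let ?J'' = "\<lambda>z. \<Sum>m. diffs (diffs ?c) m * z ^ m"
  have s0: "summable (\<lambda>m. ?c m * z ^ m)" for z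
    using summable_bessel[of z] by simp
  have s1: "summable (\<lambda>m. diffs ?c m * z ^ m)" for z
    by (rule termdiff_converges_all[OF s0])
  have s2: "summable (\<lambda>m. diffs (diffs ?c) m * z ^ m)" for z
    by (rule termdiff_converges_all[OF s1])
  show "(bessel_J has_real_derivative ?J' z) (at z)" for z
    using termdiffs_strong_converges_everywhere[OF s0, of z]
    by (simp add: bessel_J_def[abs_def])
  show "(?J' has_real_derivative ?J'' z) (at z)" for z
    using termdiffs_strong_converges_everywhere[OF s1, of z] by simp
  have pos: "diffs ?c m \<ge> 0" for m
    by (simp add: diffs_def)
  show "?J' z \<ge> 0" if "z \<ge> 0" for z
    using that pos by (intro suminf_nonneg s1) simp
  show "bessel_J 0 = 1"
    using powser_zero[of ?c] by (simp add: bessel_J_def)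
  show "z * ?J'' z + ?J' z = bessel_J z" for z
  proof -
    have eq: "real m * diffs ?c m * z ^ m + diffs ?c m * z ^ m = ?c m * z ^ m" for m
    proof -
      have "a * (a * (1 / (a * f)\<^sup>2)) = 1 / f\<^sup>2" if "a \<noteq> 0" for a f :: real
        using that by (simp add: power2_eq_square)
      from this[of "real m + 1" "fact m"] have "(real m + 1) * diffs ?c m = ?c m"
        by (simp add: diffs_def add.commute)
      then have "((real m + 1) * diffs ?c m) * z ^ m = ?c m * z ^ m"
        by simp
      then show ?thesis by (simp add: algebra_simps)
    qed
    have "(\<lambda>m. of_nat m * diffs ?c m * z ^ (m - Suc 0)) sums ?J'' z"
      using diffs_equiv[OF s2] by simp
    then have "(\<lambda>m. z * (of_nat m * diffs ?c m * z ^ (m - Suc 0))) sums (z * ?J'' z)"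
      by (rule sums_mult)
    moreover have "z * (of_nat m * diffs ?c m * z ^ (m - Suc 0)) = real m * diffs ?c m * z ^ m" for m
      by (cases m) simp_all
    ultimately have "(\<lambda>m. real m * diffs ?c m * z ^ m) sums (z * ?J'' z)"
      by simp
    from sums_add[OF this summable_sums[OF s1[of z]]] show ?thesis
      unfolding eq by (simp add: bessel_J_def sums_iff)
  qed
qed

lemma bessel_I0_derivs:
  obtains I1 where "\<And>x. (bessel_I0 has_real_derivative I1 x) (at x)"
    and "\<And>x. ((\<lambda>t. t * I1 t) has_real_derivative x * bessel_I0 x) (at x)"
    and "\<And>x. x \<ge> 0 \<Longrightarrow> I1 x \<ge> 0"
    and "continuous_on UNIV I1"
proof -
  obtain J' J'' where J: "\<And>z. (bessel_J has_real_derivative J' z) (at z)"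
    "\<And>z. (J' has_real_derivative J'' z) (at z)"
    "\<And>z. z * J'' z + J' z = bessel_J z" "\<And>z. z \<ge> 0 \<Longrightarrow> J' z \<ge> 0" "bessel_J 0 = 1"
    by (rule bessel_J_derivs) blast
  have q: "((\<lambda>x. x\<^sup>2 / 4) has_real_derivative x / 2) (at x)" for x :: real
    by (auto intro!: derivative_eq_intros)
  show ?thesis
  proof
    show "(bessel_I0 has_real_derivative x / 2 * J' (x\<^sup>2 / 4)) (at x)" for x
      unfolding bessel_I0_eq[abs_def]
      using DERIV_chain2[OF J(1) q] by (simp add: mult.commute)
    have "((\<lambda>t. t * (t / 2 * J' (t\<^sup>2 / 4))) has_real_derivative
            x * ((x\<^sup>2 / 4) * J'' (x\<^sup>2 / 4) + J' (x\<^sup>2 / 4))) (at x)" for x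
    proof -
      have "((\<lambda>t. J' (t\<^sup>2 / 4)) has_real_derivative J'' (x\<^sup>2 / 4) * (x / 2)) (at x)"
        by (rule DERIV_chain2[OF J(2) q])
      then have "((\<lambda>t. t\<^sup>2 / 2 * J' (t\<^sup>2 / 4)) has_real_derivative
          x * J' (x\<^sup>2 / 4) + J'' (x\<^sup>2 / 4) * (x / 2) * (x\<^sup>2 / 2)) (at x)"
        by (intro DERIV_mult) (auto intro!: derivative_eq_intros)
      then show ?thesis
        by (simp add: field_simps power2_eq_square)
    qed
    then show "((\<lambda>t. t * (t / 2 * J' (t\<^sup>2 / 4))) has_real_derivative x * bessel_I0 x) (at x)" for x
      unfolding J(3) bessel_I0_eq .
    show "x / 2 * J' (x\<^sup>2 / 4) \<ge> 0" if "x \<ge> 0" for x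
      using that J(4)[of "x\<^sup>2 / 4"] by simp
    have "continuous_on UNIV (\<lambda>x. J' (x\<^sup>2 / 4))"
      by (intro continuous_at_imp_continuous_on ballI DERIV_isCont[OF DERIV_chain2[OF J(2) q]])
    then show "continuous_on UNIV (\<lambda>x. x / 2 * J' (x\<^sup>2 / 4))"
      by (intro continuous_on_mult continuous_on_divide continuous_on_id continuous_on_const) auto
  qed
qed

text \<open>The second fact is the modified Bessel equation in divergence form, that is, the radial form of
\<open>\<Delta> v = v\<close>.\<close>

lemma bessel_I0_has_derivative: "(bessel_I0 has_real_derivative deriv bessel_I0 x) (at x)"
  and bessel_ode: "((\<lambda>t. t * deriv bessel_I0 t) has_real_derivative x * bessel_I0 x) (at x)"
  and deriv_bessel_I0_nonneg: "x \<ge> 0 \<Longrightarrow> deriv bessel_I0 x \<ge> 0"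
  and continuous_on_deriv_bessel_I0: "continuous_on UNIV (deriv bessel_I0)"
proof -
  obtain I1 where I: "\<And>x. (bessel_I0 has_real_derivative I1 x) (at x)"
    "\<And>x. ((\<lambda>t. t * I1 t) has_real_derivative x * bessel_I0 x) (at x)"
    "\<And>x. x \<ge> 0 \<Longrightarrow> I1 x \<ge> 0" "continuous_on UNIV I1"
    by (rule bessel_I0_derivs) blast
  have "deriv bessel_I0 = I1"
    using I(1) by (auto intro: DERIV_imp_deriv)
  with I show "(bessel_I0 has_real_derivative deriv bessel_I0 x) (at x)"
    "((\<lambda>t. t * deriv bessel_I0 t) has_real_derivative x * bessel_I0 x) (at x)"
    "x \<ge> 0 \<Longrightarrow> deriv bessel_I0 x \<ge> 0" "continuous_on UNIV (deriv bessel_I0)"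
    by simp_all
qed

lemma continuous_on_bessel_I0: "continuous_on S bessel_I0"
  by (intro continuous_at_imp_continuous_on ballI DERIV_isCont[OF bessel_I0_has_derivative])

lemma borel_measurable_bessel [measurable]:
  "bessel_I0 \<in> borel_measurable borel" "deriv bessel_I0 \<in> borel_measurable borel"
  by (auto intro!: borel_measurable_continuous_onI continuous_on_bessel_I0 continuous_on_deriv_bessel_I0)

lemma bessel_I0_0: "bessel_I0 0 = 1"
  by (metis bessel_I0_eq bessel_J_derivs power_zero_numeral div_0)

lemma bessel_I0_mono:
  assumes "0 \<le> x" "x \<le> y"
  shows "bessel_I0 x \<le> bessel_I0 y"
  using assms(2)
  by (rule DERIV_nonneg_imp_nondecreasing)
    (meson assms(1) order_trans bessel_I0_has_derivative deriv_bessel_I0_nonneg)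

lemma bessel_I0_ge_1: "x \<ge> 0 \<Longrightarrow> bessel_I0 x \<ge> 1"
  using bessel_I0_mono[of 0 x] by (simp add: bessel_I0_0)

text \<open>For \<open>R > 1\<close> the root equation says that this quotient equals \<open>1 / ln R\<close>.\<close>

definition bessel_quot :: "real \<Rightarrow> real" where
  "bessel_quot t = t * deriv bessel_I0 t / bessel_I0 t"

lemma bessel_quot_has_derivative:
  assumes "t > 0"
  shows "(bessel_quot has_real_derivative t - (bessel_quot t)\<^sup>2 / t) (at t)"
proof -
  have I: "bessel_I0 t > 0"
    using bessel_I0_ge_1[of t] assms by linarith
  have "(bessel_quot has_real_derivative
      (t * bessel_I0 t * bessel_I0 t - t * deriv bessel_I0 t * deriv bessel_I0 t) / (bessel_I0 t * bessel_I0 t)) (at t)"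
    unfolding bessel_quot_def[abs_def] using I
    by (intro DERIV_divide bessel_ode bessel_I0_has_derivative) simp
  also have "(t * bessel_I0 t * bessel_I0 t - t * deriv bessel_I0 t * deriv bessel_I0 t) / (bessel_I0 t * bessel_I0 t)
      = t - (bessel_quot t)\<^sup>2 / t"
    using I assms by (simp add: bessel_quot_def diff_divide_distrib power2_eq_square)
  finally show ?thesis .
qed

text \<open>With \<open>E = (t I\<^sub>0)\<^sup>2 - (t I\<^sub>0')\<^sup>2\<close> the Bessel equation gives \<open>E' = 2 t I\<^sub>0\<^sup>2 > 0\<close>, while \<open>E 0 = 0\<close>. The
bound says exactly that the derivative of the quotient is positive.\<close>

lemma bessel_quot_less:
  assumes "t > 0"
  shows "(bessel_quot t)\<^sup>2 < t\<^sup>2"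
proof -
  define E where "E = (\<lambda>s. (s * bessel_I0 s)\<^sup>2 - (s * deriv bessel_I0 s)\<^sup>2)"
  have E: "(E has_real_derivative 2 * s * (bessel_I0 s)\<^sup>2) (at s)" for s
    unfolding E_def
    by (rule derivative_eq_intros bessel_ode bessel_I0_has_derivative refl)+
      (simp add: power2_eq_square algebra_simps)
  have E_pos: "2 * s * (bessel_I0 s)\<^sup>2 > 0" if "s > 0" for s
    using that bessel_I0_ge_1[of s] by (intro mult_pos_pos) auto
  have "continuous_on {0..t} E"
    by (intro continuous_at_imp_continuous_on ballI DERIV_isCont[OF E])
  then have "E 0 < E t"
    using assms E E_pos by (intro DERIV_pos_imp_increasing_open[of 0 t E]) blast+
  then have "(t * deriv bessel_I0 t)\<^sup>2 < t\<^sup>2 * (bessel_I0 t)\<^sup>2"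
    by (simp add: E_def power_mult_distrib)
  moreover have "(bessel_I0 t)\<^sup>2 > 0"
    using bessel_I0_ge_1[of t] assms by (intro zero_less_power) linarith
  ultimately show ?thesis
    by (simp add: bessel_quot_def power_divide divide_less_eq)
qed

lemma bessel_quot_strict_mono:
  assumes "0 < s" "s < t"
  shows "bessel_quot s < bessel_quot t"
proof (rule DERIV_pos_imp_increasing[OF assms(2)])
  fix x assume "s \<le> x" "x \<le> t"
  with assms have x: "x > 0" by linarith
  have "x - (bessel_quot x)\<^sup>2 / x > 0"
    using bessel_quot_less[OF x] x by (simp add: field_simps power2_eq_square)
  with bessel_quot_has_derivative[OF x]
  show "\<exists>y. (bessel_quot has_real_derivative y) (at x) \<and> y > 0" by blast
qed

lemma bessel_quot_nonneg: "t > 0 \<Longrightarrow> bessel_quot t \<ge> 0"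
  using bessel_I0_ge_1[of t] deriv_bessel_I0_nonneg[of t] by (simp add: bessel_quot_def)

text \<open>If the quotient stayed below \<open>M\<close>, its derivative would be at least \<open>t - M\<^sup>2 / t \<ge> 1\<close> for
\<open>t \<ge> M + 1\<close>, and an interval of length \<open>M\<close> would suffice to climb past \<open>M\<close>.\<close>

lemma bessel_quot_unbounded:
  assumes "M > 0"
  shows "\<exists>t>0. bessel_quot t \<ge> M"
proof (rule ccontr)
  assume "\<not> ?thesis"
  then have less: "bessel_quot t < M" if "t > 0" for t
    using that by force
  have "bessel_quot (M + 1) - (M + 1) \<le> bessel_quot (2 * M + 1) - (2 * M + 1)"
  proof (rule DERIV_nonneg_imp_nondecreasing[where f = "\<lambda>x. bessel_quot x - x"])
    fix x assume x: "M + 1 \<le> x" "x \<le> 2 * M + 1"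
    then have x0: "x > 0" using assms by simp
    have "((\<lambda>x. bessel_quot x - x) has_real_derivative x - (bessel_quot x)\<^sup>2 / x - 1) (at x)"
      using x0 by (intro DERIV_diff bessel_quot_has_derivative DERIV_ident)
    moreover have "x - (bessel_quot x)\<^sup>2 / x - 1 \<ge> 0"
    proof -
      have "(bessel_quot x)\<^sup>2 \<le> M\<^sup>2"
        using less[OF x0] bessel_quot_nonneg[OF x0] by (intro power_mono) auto
      also have "\<dots> \<le> M * x"
        using x assms by (simp add: power2_eq_square)
      also have "\<dots> \<le> (x - 1) * x"
        using x x0 by (intro mult_right_mono) auto
      finally show ?thesis using x0 by (simp add: field_simps)
    qed
    ultimately show "\<exists>y. ((\<lambda>x. bessel_quot x - x) has_real_derivative y) (at x) \<and> y \<ge> 0"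
      by blast
  qed (use assms in simp)
  with less[of "2 * M + 1"] bessel_quot_nonneg[of "M + 1"] assms show False by simp
qed

lemma mu0_root_iff:
  assumes "R > 1"
  shows "mu0_root R t \<longleftrightarrow> 0 < t \<and> bessel_quot t = 1 / ln R"
proof (cases "t > 0")
  case True
  have "bessel_I0 t > 0" "ln R > 0"
    using bessel_I0_ge_1[of t] True assms by auto
  then show ?thesis
    by (simp add: mu0_root_def bessel_quot_def field_simps)
qed (simp add: mu0_root_def)

lemma ex1_mu0_root:
  assumes "R > 1"
  shows "\<exists>!t. mu0_root R t"
proof -
  have L: "1 / ln R > 0" using assms by simp
  obtain b where b: "b > 0" "bessel_quot b \<ge> 1 / ln R"
    using bessel_quot_unbounded[OF L] by blast
  define a where "a = min b (1 / ln R)"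
  have a: "a > 0" "a \<le> b" "a \<le> 1 / ln R"
    using b L by (auto simp: a_def)
  have "bessel_quot a \<le> 1 / ln R"
    using bessel_quot_less[OF a(1)] a power2_less_imp_less[of "bessel_quot a" a] by linarith
  moreover have "continuous_on {a..b} bessel_quot"
    using a(1) by (intro continuous_at_imp_continuous_on ballI DERIV_isCont[OF bessel_quot_has_derivative]) auto
  ultimately obtain t where "a \<le> t" "t \<le> b" "bessel_quot t = 1 / ln R"
    using IVT'[of bessel_quot a "1 / ln R" b] b a by blast
  then have "mu0_root R t"
    using a mu0_root_iff[OF assms] by simp
  moreover have "t = t'" if "mu0_root R t" "mu0_root R t'" for t t'
    using that bessel_quot_strict_mono[of t t'] bessel_quot_strict_mono[of t' t]
    unfolding mu0_root_iff[OF assms] by (metis less_irrefl linorder_neqE)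
  ultimately show ?thesis by blast
qed

lemma mu0_root_mu0: "R > 1 \<Longrightarrow> mu0_root R (mu0 R)"
  unfolding mu0_def by (rule theI') (rule ex1_mu0_root)

lemma mu0_antimono:
  assumes "1 < R1" "R1 < R2"
  shows "mu0 R2 < mu0 R1"
proof -
  have "mu0_root R1 (mu0 R1)" "mu0_root R2 (mu0 R2)"
    using assms by (auto intro: mu0_root_mu0)
  then have mu: "0 < mu0 R1" "bessel_quot (mu0 R1) = 1 / ln R1" "bessel_quot (mu0 R2) = 1 / ln R2"
    using assms by (auto simp: mu0_root_iff)
  have "1 / ln R2 < 1 / ln R1"
    using assms by (intro divide_strict_left_mono) auto
  with mu bessel_quot_strict_mono[of "mu0 R1" "mu0 R2"] show ?thesis
    by (metis less_asym linorder_neqE)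
qed

section \<open>The logarithmic kernel on a disc\<close>

definition log_kernel :: "real ^ 2 \<Rightarrow> real ^ 2 \<Rightarrow> real" where
  "log_kernel x y = ln (1 / norm (x - y))"

abbreviation disc :: "real \<Rightarrow> (real ^ 2) measure" where
  "disc R \<equiv> lebesgue_on (ball 0 R)"

lemma borel_measurable_discI: "f \<in> borel_measurable borel \<Longrightarrow> f \<in> borel_measurable (disc R)"
  by (intro measurable_restrict_space1 measurable_completion) simp

lemma space_disc: "space (disc R) = ball 0 R"
  by (simp add: space_restrict_space)

lemma finite_measure_disc: "finite_measure (disc R)"
  by (intro finite_measure_lebesgue_on lmeasurable_ball)

lemma AE_disc_iff: "(AE x in disc R. P x) \<longleftrightarrow> (AE x in lborel. x \<in> ball 0 R \<longrightarrow> P x)"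
  by (simp add: AE_restrict_space_iff AE_completion_iff)

lemma integral_disc:
  fixes f :: "real ^ 2 \<Rightarrow> real"
  assumes [measurable]: "f \<in> borel_measurable borel"
  shows "(LINT y|disc R. f y) = (LINT y|lborel. indicator (ball 0 R) y * f y)"
proof -
  have "(LINT y|disc R. f y) = (LINT y|lebesgue. indicator (ball 0 R) y * f y)"
    by (simp add: integral_restrict_space)
  also have "\<dots> = (LINT y|lborel. indicator (ball 0 R) y * f y)"
    by (rule integral_completion) simp
  finally show ?thesis .
qed

lemma integrable_disc:
  fixes f :: "real ^ 2 \<Rightarrow> real"
  assumes [measurable]: "f \<in> borel_measurable borel"
  shows "integrable (disc R) f \<longleftrightarrow> integrable lborel (\<lambda>y. indicator (ball 0 R) y * f y)"
proof -
  have "integrable (disc R) f \<longleftrightarrow> integrable lebesgue (\<lambda>y. indicator (ball 0 R) y * f y)"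
    by (simp add: integrable_restrict_space)
  also have "\<dots> \<longleftrightarrow> integrable lborel (\<lambda>y. indicator (ball 0 R) y * f y)"
    by (rule integrable_completion) simp
  finally show ?thesis .
qed

lemma log_kernel_nn_integral_le:
  assumes "R > 0" and x: "x \<in> ball 0 R"
  shows "(\<integral>\<^sup>+ y. ennreal \<bar>log_kernel x y\<bar> \<partial>disc R) \<le> ennreal (pi / 2 + 2 * R * (pi * R\<^sup>2))"
proof -
  let ?s = "\<lambda>y. if norm (x - y) < 1 then ln (1 / norm (x - y)) else 0"
  have s_nonneg: "?s y \<ge> 0" for y
    by (cases "x = y") (auto intro!: ln_ge_zero)
  have "(\<integral>\<^sup>+ y. ennreal \<bar>log_kernel x y\<bar> \<partial>disc R)
      = (\<integral>\<^sup>+ y. ennreal \<bar>log_kernel x y\<bar> * indicator (ball 0 R) y \<partial>lborel)"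
    by (simp add: nn_integral_restrict_space nn_integral_completion)
  also have "\<dots> \<le> (\<integral>\<^sup>+ y. ennreal (?s y) + ennreal (2 * R) * indicator (ball 0 R) y \<partial>lborel)"
  proof (rule nn_integral_mono)
    fix y :: "real ^ 2"
    have "\<bar>log_kernel x y\<bar> \<le> ?s y + 2 * R" if y: "y \<in> ball 0 R"
    proof (cases "norm (x - y) < 1")
      case True
      then show ?thesis
        using s_nonneg[of y] \<open>R > 0\<close> by (simp add: log_kernel_def)
    next
      case False
      have "norm (x - y) \<le> norm x + norm y"
        by (rule norm_triangle_ineq4)
      also have "\<dots> \<le> 2 * R"
        using x y by simp
      finally have "norm (x - y) \<le> 2 * R" .
      moreover have "ln (norm (x - y)) \<le> norm (x - y)"
        using False by (intro ln_bound) linarith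
      ultimately have "ln (norm (x - y)) \<le> 2 * R"
        by linarith
      then show ?thesis
        using False \<open>R > 0\<close> by (simp add: log_kernel_def ln_div)
    qed
    then show "ennreal \<bar>log_kernel x y\<bar> * indicator (ball 0 R) y
       \<le> ennreal (?s y) + ennreal (2 * R) * indicator (ball 0 R) y"
      using s_nonneg[of y] \<open>R > 0\<close>
      by (cases "y \<in> ball 0 R") (simp_all add: ennreal_leI flip: ennreal_plus)
  qed
  also have "\<dots> = (\<integral>\<^sup>+ y. ennreal (?s y) \<partial>lborel) + ennreal (2 * R) * emeasure lborel (ball 0 R :: (real ^ 2) set)"
    by (subst nn_integral_add) (simp_all add: nn_integral_cmult)
  also have "\<dots> \<le> ennreal (pi / 2) + ennreal (2 * R) * emeasure lborel (ball 0 R :: (real ^ 2) set)"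
    by (intro add_right_mono nn_integral_ln_singularity)
  also have "\<dots> = ennreal (pi / 2 + 2 * R * (pi * R\<^sup>2))"
    using \<open>R > 0\<close> by (simp add: emeasure_disc flip: ennreal_mult ennreal_plus)
  finally show ?thesis .
qed

lemma fst_snd_disc_measurable:
  "fst \<in> borel_measurable (disc R \<Otimes>\<^sub>M disc R)" "snd \<in> borel_measurable (disc R \<Otimes>\<^sub>M disc R)"
  by (rule measurable_compose[OF measurable_fst borel_measurable_discI[of "\<lambda>x. x"]]
           measurable_compose[OF measurable_snd borel_measurable_discI[of "\<lambda>x. x"]], simp)+

lemma schur_kernel_log:
  assumes "R > 0"
  shows "schur_kernel (disc R) log_kernel (pi / 2 + 2 * R * (pi * R\<^sup>2))"
proof (intro schur_kernel.intro schur_kernel_axioms.intro finite_measure_disc)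
  note [measurable] = fst_snd_disc_measurable
  have "(\<lambda>p. ln (1 / norm (fst p - snd p))) \<in> borel_measurable (disc R \<Otimes>\<^sub>M disc R)"
    by measurable
  then show "case_prod log_kernel \<in> borel_measurable (disc R \<Otimes>\<^sub>M disc R)"
    by (simp add: case_prod_beta' log_kernel_def)
  show "log_kernel x y = log_kernel y x" for x y
    by (simp add: log_kernel_def norm_minus_commute)
  show "(\<integral>\<^sup>+ y. ennreal \<bar>log_kernel x y\<bar> \<partial>disc R) \<le> ennreal (pi / 2 + 2 * R * (pi * R\<^sup>2))"
    if "x \<in> space (disc R)" for x
    using that log_kernel_nn_integral_le[OF assms] by (simp add: space_disc)
qed

text \<open>On mean-zero functions the form is half the
form of the kernel \<open>- ln (1 - chordal_kernel x y)\<close>, whose series in powers of the chordal kernel has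
positive semidefinite terms. The kernel bounds its own partial sums, so dominated convergence passes
positivity to the limit.\<close>

lemma log_form_nonneg:
  assumes "R > 0" and u: "sq_integrable (disc R) u" and mean0: "(LINT x|disc R. u x) = 0"
  shows "schur_kernel.form (disc R) log_kernel u u \<ge> 0"
proof -
  interpret schur_kernel "disc R" log_kernel "pi / 2 + 2 * R * (pi * R\<^sup>2)"
    by (rule schur_kernel_log[OF assms(1)])
  note [measurable] = fst_snd_disc_measurable sq_integrable_measurable[OF u]
  let ?P = "disc R \<Otimes>\<^sub>M disc R"
  define A :: "real ^ 2 \<Rightarrow> real" where "A x = ln (1 + (norm x)\<^sup>2)" for x
  \<comment> \<open>Off the diagonal the bracket in \<open>T\<close> is \<open>- ln (1 - chordal_kernel x y)\<close>; this form of it is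
    integrable by what is known about the logarithmic kernel.\<close>
  define T where "T p = (2 * log_kernel (fst p) (snd p) + A (fst p) + A (snd p)) * u (fst p) * u (snd p)" for p
  define S where "S N p = (\<Sum>n<N. chordal_kernel (fst p) (snd p) ^ Suc n / real (Suc n)) * u (fst p) * u (snd p)" for N p
  have u_int: "integrable (disc R) u"
    by (rule sq_integrable_imp_integrable[OF u])
  have Au_int: "integrable (disc R) (\<lambda>x. A x * u x)"
  proof (rule Bochner_Integration.integrable_bound)
    show "integrable (disc R) (\<lambda>x. ln (1 + R\<^sup>2) * u x)"
      using u_int by simp
    have [measurable]: "A \<in> borel_measurable (disc R)"
      by (rule borel_measurable_discI) (simp add: A_def[abs_def])
    show "(\<lambda>x. A x * u x) \<in> borel_measurable (disc R)"
      by measurable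
    have "\<bar>A x\<bar> \<le> ln (1 + R\<^sup>2)" if "x \<in> ball 0 R" for x
    proof -
      have "(norm x)\<^sup>2 \<le> R\<^sup>2"
        using that by (intro power_mono) auto
      then show ?thesis by (simp add: A_def add_pos_nonneg)
    qed
    then have "\<bar>A x\<bar> * \<bar>u x\<bar> \<le> \<bar>ln (1 + R\<^sup>2)\<bar> * \<bar>u x\<bar>" if "x \<in> ball 0 R" for x
      using that by (intro mult_right_mono) (auto intro: order_trans[OF _ abs_ge_self])
    then show "AE x in disc R. norm (A x * u x) \<le> norm (ln (1 + R\<^sup>2) * u x)"
      by (intro AE_I2) (simp add: space_disc abs_mult)
  qed
  have T_eq: "T p = 2 * (log_kernel (fst p) (snd p) * u (fst p) * u (snd p))
      + ((A (fst p) * u (fst p)) * u (snd p) + u (fst p) * (A (snd p) * u (snd p)))" for p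
    by (simp add: T_def algebra_simps)
  have K_int: "integrable ?P (\<lambda>p. log_kernel (fst p) (snd p) * u (fst p) * u (snd p))"
    using integrable_kernel[OF u u] by (simp add: case_prod_beta')
  note tensor = integral_tensor[OF Au_int u_int] integral_tensor[OF u_int Au_int]
  have T_int: "integrable ?P T"
    unfolding T_eq[abs_def] using K_int tensor by simp
  have T_val: "integral\<^sup>L ?P T = 2 * form u u"
    unfolding T_eq[abs_def] using K_int tensor by (simp add: form_eq_product_integral[OF u u] mean0)
  have series: "(\<lambda>N. S N p) \<longlonglongrightarrow> T p \<and> (\<forall>N. \<bar>S N p\<bar> \<le> \<bar>T p\<bar>)" if "fst p \<noteq> snd p" for p
  proof -
    define s where "s = chordal_kernel (fst p) (snd p)"
    have s: "0 \<le> s" "s < 1"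
      using that by (simp_all add: s_def chordal_kernel_nonneg chordal_kernel_less_1)
    have "- ln (1 - s) = 2 * log_kernel (fst p) (snd p) + A (fst p) + A (snd p)"
    proof -
      have pos: "1 + (norm (fst p))\<^sup>2 > 0" "1 + (norm (snd p))\<^sup>2 > 0" "norm (fst p - snd p) > 0"
        using that by (simp_all add: add_pos_nonneg)
      then show ?thesis
        unfolding s_def one_minus_chordal_kernel log_kernel_def A_def
        by (simp add: ln_divide_pos ln_mult_pos ln_realpow)
    qed
    with neg_ln_series[OF s]
    have sums: "(\<lambda>n. s ^ Suc n / real (Suc n)) sums (2 * log_kernel (fst p) (snd p) + A (fst p) + A (snd p))"
      (is "_ sums ?L") by simp
    have "(\<lambda>N. (\<Sum>n<N. s ^ Suc n / real (Suc n)) * u (fst p) * u (snd p)) \<longlonglongrightarrow> ?L * u (fst p) * u (snd p)"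
      using sums unfolding sums_def by (intro tendsto_mult tendsto_const)
    moreover have "\<bar>\<Sum>n<N. s ^ Suc n / real (Suc n)\<bar> \<le> \<bar>?L\<bar>" for N
    proof -
      have "0 \<le> (\<Sum>n<N. s ^ Suc n / real (Suc n))"
        using s by (intro sum_nonneg) simp
      moreover have "(\<Sum>n<N. s ^ Suc n / real (Suc n)) \<le> (\<Sum>n. s ^ Suc n / real (Suc n))"
        using s by (intro sum_le_suminf sums_summable[OF sums]) auto
      moreover have "(\<Sum>n. s ^ Suc n / real (Suc n)) = ?L"
        using sums by (rule sums_unique[symmetric])
      ultimately show ?thesis by linarith
    qed
    ultimately show ?thesis
      by (auto simp: S_def T_def s_def abs_mult intro!: mult_right_mono)
  qed
  have off_diag: "AE p in ?P. fst p \<noteq> snd p"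
  proof (rule pair.AE_pair_measure)
    show "{p \<in> space ?P. fst p \<noteq> snd p} \<in> sets ?P"
      by measurable
    have "AE y in disc R. x \<noteq> y" for x
      unfolding AE_disc_iff using AE_lborel_singleton[of x] by eventually_elim auto
    then show "AE x in disc R. AE y in disc R. fst (x, y) \<noteq> snd (x, y)"
      by simp
  qed
  have [measurable]: "chordal i \<in> borel_measurable (disc R)" for i
    by (rule borel_measurable_discI) measurable
  note power = integral_power_kernel_nonneg[of 4 chordal, OF _ abs_chordal_le u_int, folded chordal_kernel_def]
  have S_eq: "S N p = (\<Sum>n<N. (chordal_kernel (fst p) (snd p) ^ Suc n * u (fst p) * u (snd p)) / real (Suc n))" for N p
    by (simp add: S_def sum_distrib_right)
  have S_int: "integrable ?P (S N)" and S_nonneg: "integral\<^sup>L ?P (S N) \<ge> 0" for N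
    unfolding S_eq[abs_def] using power
    by (auto intro!: Bochner_Integration.integrable_sum sum_nonneg divide_nonneg_nonneg
             simp: Bochner_Integration.integral_sum simp del: power_Suc)
  have "(\<lambda>N. integral\<^sup>L ?P (S N)) \<longlonglongrightarrow> integral\<^sup>L ?P T"
  proof (rule integral_dominated_convergence)
    show "integrable ?P (\<lambda>p. \<bar>T p\<bar>)"
      using T_int by simp
    show "AE p in ?P. (\<lambda>N. S N p) \<longlonglongrightarrow> T p"
      using off_diag by eventually_elim (use series in blast)
    show "AE p in ?P. norm (S N p) \<le> \<bar>T p\<bar>" for N
      using off_diag by eventually_elim (use series in simp)
  qed (use S_int T_int in auto)
  then have "integral\<^sup>L ?P T \<ge> 0"
    using S_nonneg by (intro LIMSEQ_le_const) auto
  then show ?thesis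
    using T_val by simp
qed

text \<open>The mass of \<open>I\<^sub>0 (k r)\<close> on a disc is, by the Bessel equation, the flux of its gradient through the
boundary circle divided by \<open>k\<^sup>2\<close>.\<close>

lemma integral_bessel_disc:
  assumes k: "k > 0" and "S \<ge> 0"
  shows "(LINT y|lborel. indicator (ball 0 S) y * bessel_I0 (k * norm (y :: real ^ 2)))
       = 2 * pi * S * deriv bessel_I0 (k * S) / k"
proof -
  have c: "((*) k has_real_derivative k) (at t)" for t
    by (auto intro!: derivative_eq_intros)
  have dI: "((\<lambda>t. bessel_I0 (k * t)) has_real_derivative k * deriv bessel_I0 (k * t)) (at t)" for t
    using DERIV_chain2[OF bessel_I0_has_derivative c, of t] by (simp only: mult.commute[of k "deriv bessel_I0 (k * t)"])
  have dP: "((\<lambda>t. k * t * deriv bessel_I0 (k * t)) has_real_derivative k\<^sup>2 * (t * bessel_I0 (k * t))) (at t)" for t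
  proof -
    have "k\<^sup>2 * (t * bessel_I0 (k * t)) = k * t * bessel_I0 (k * t) * k"
      by (simp add: power2_eq_square)
    then show ?thesis
      using DERIV_chain2[OF bessel_ode c, of t] by (simp only:)
  qed
  \<comment> \<open>Integrating \<open>pi * t\<^sup>2\<close> against the derivative of \<open>bessel_I0 (k * t)\<close> by parts; the Bessel equation
    provides an antiderivative of the remaining \<open>t * bessel_I0 (k * t)\<close>.\<close>
  define H where "H t = pi * (t\<^sup>2 * bessel_I0 (k * t) - 2 / k\<^sup>2 * (k * t * deriv bessel_I0 (k * t)))" for t
  have dH: "(H has_real_derivative k * deriv bessel_I0 (k * t) * (pi * t\<^sup>2)) (at t)" for t
  proof -
    have "(H has_real_derivative pi * (2 * t * bessel_I0 (k * t) + k * deriv bessel_I0 (k * t) * t\<^sup>2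
        - 2 / k\<^sup>2 * (k\<^sup>2 * (t * bessel_I0 (k * t))))) (at t)"
      unfolding H_def[abs_def]
      by (intro DERIV_cmult DERIV_diff DERIV_mult dI dP) (auto intro!: derivative_eq_intros)
    then show ?thesis
      using k by (simp add: algebra_simps)
  qed
  have "has_bochner_integral lborel (\<lambda>y :: real ^ 2. bessel_I0 (k * max 0 (norm y)) * (indicator (ball 0 S) y * 1))
      (bessel_I0 (k * S) * (pi * S\<^sup>2) - (H S - H 0))"
  proof (rule radial_layer_cake[where G = "\<lambda>t. bessel_I0 (k * t)" and g = "\<lambda>t. k * deriv bessel_I0 (k * t)" and W = "\<lambda>t. pi * t\<^sup>2"])
    show "integrable lborel (\<lambda>y :: real ^ 2. indicator (ball 0 S) y * (1 :: real) :: real)"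
      by (simp add: emeasure_disc integrable_indicator_iff \<open>S \<ge> 0\<close>)
    show "(LINT y|lborel. indicator (ball 0 t) (y :: real ^ 2) * (1 :: real)) = pi * t\<^sup>2" if "0 \<le> t" "t \<le> S" for t
      using that by (simp add: measure_def emeasure_disc)
  qed (use dI dH k \<open>S \<ge> 0\<close> deriv_bessel_I0_nonneg in auto)
  then show ?thesis
    using k by (simp add: has_bochner_integral_iff H_def power2_eq_square field_simps)
qed

text \<open>By Newton's theorem the potential of the radial function \<open>I\<^sub>0 (k r)\<close> is a one-dimensional integral,
which evaluates to a multiple of \<open>I\<^sub>0 (k r)\<close> plus a constant proportional to
\<open>ln R * t * I\<^sub>0' t - I\<^sub>0 t\<close> at \<open>t = k R\<close>. The equation that defines \<open>mu0 R\<close> is the vanishing of this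
constant. At the origin \<open>ln (norm x)\<close> is a default value, hence \<open>x \<noteq> 0\<close>.\<close>

lemma log_potential_bessel:
  assumes R: "R > 1" and x: "x \<in> ball 0 R" "x \<noteq> 0"
  defines "k \<equiv> mu0 R / R"
  shows "(LINT y|disc R. log_kernel x y * bessel_I0 (k * norm y)) = - (2 * pi / k\<^sup>2) * bessel_I0 (k * norm x)"
proof -
  have mu: "mu0 R > 0" "bessel_I0 (mu0 R) - ln R * mu0 R * deriv bessel_I0 (mu0 R) = 0"
    using mu0_root_mu0[OF R] by (simp_all add: mu0_root_def)
  have k: "k > 0" "k * R = mu0 R"
    using R mu(1) by (simp_all add: k_def)
  define w where "w y = bessel_I0 (k * norm y)" for y :: "real ^ 2"
  define F where "F r = indicator {..<R} r * bessel_I0 (k * r)" for r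
  have [measurable]: "w \<in> borel_measurable borel" "F \<in> borel_measurable borel"
    unfolding w_def[abs_def] F_def[abs_def] by measurable
  have F_norm: "F (norm y) = indicator (ball 0 R) y * w y" for y
    by (simp add: F_def w_def indicator_def)
  have w_nonneg: "w y \<ge> 0" and w_bound: "norm y \<le> R \<Longrightarrow> w y \<le> bessel_I0 (mu0 R)" for y
    using bessel_I0_ge_1[of "k * norm y"] bessel_I0_mono[of "k * norm y" "k * R"] k(1)
      mult_left_mono[of "norm y" R k]
    unfolding k(2)[symmetric] by (auto simp: w_def)
  have w_int: "integrable lborel (\<lambda>y. g y * F (norm y))"
    if g: "integrable lborel (\<lambda>y. indicator (ball 0 R) y * g y)" and [measurable]: "g \<in> borel_measurable borel"
    for g :: "real ^ 2 \<Rightarrow> real"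
  proof (rule Bochner_Integration.integrable_bound)
    show "integrable lborel (\<lambda>y. bessel_I0 (mu0 R) * (indicator (ball 0 R) y * g y))"
      using g by simp
    show "AE y in lborel. norm (g y * F (norm y)) \<le> norm (bessel_I0 (mu0 R) * (indicator (ball 0 R) y * g y))"
      using w_bound w_nonneg bessel_I0_ge_1[of "mu0 R"] mu(1)
      by (intro AE_I2) (auto simp: F_norm indicator_def abs_mult mult.commute intro!: mult_right_mono)
  qed measurable
  have "integrable lborel (\<lambda>y. 1 * F (norm (y :: real ^ 2)))"
    using R by (intro w_int) (simp_all add: integrable_indicator_iff emeasure_disc)
  then have int1: "integrable lborel (\<lambda>y :: real ^ 2. F (norm y))"
    by simp
  have "integrable (disc R) (log_kernel x)"
  proof (rule integrableI_bounded)
    show "log_kernel x \<in> borel_measurable (disc R)"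
      by (rule borel_measurable_discI) (simp add: log_kernel_def[abs_def])
    have "(\<integral>\<^sup>+ y. ennreal (norm (log_kernel x y)) \<partial>disc R) \<le> ennreal (pi / 2 + 2 * R * (pi * R\<^sup>2))"
      using log_kernel_nn_integral_le[of R x] R x by simp
    then show "(\<integral>\<^sup>+ y. ennreal (norm (log_kernel x y)) \<partial>disc R) < \<infinity>"
      by (rule le_less_trans) simp
  qed
  moreover have "log_kernel x = (\<lambda>y. - ln (norm (x - y)))"
    by (simp add: log_kernel_def fun_eq_iff ln_div)
  ultimately have "integrable (disc R) (\<lambda>y. ln (norm (x - y)))"
    by simp
  then have int: "integrable lborel (\<lambda>y. ln (norm (x - y)) * F (norm y))"
    by (intro w_int) (simp_all add: integrable_disc)
  have a: "0 < norm x" "norm x \<le> R"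
    using x by simp_all
  have c: "((*) k has_real_derivative k) (at t)" for t
    by (auto intro!: derivative_eq_intros)
  have dH: "((\<lambda>t. 2 * pi / k\<^sup>2 * bessel_I0 (k * t)) has_real_derivative 1 / t * (2 * pi * t * deriv bessel_I0 (k * t) / k)) (at t)"
    if "t > 0" for t
    using DERIV_cmult[OF DERIV_chain2[OF bessel_I0_has_derivative c], of "2 * pi / k\<^sup>2" t] that k
    by (simp add: power2_eq_square)
  have "has_bochner_integral lborel (\<lambda>y. ln (max (norm x) (norm y)) * (indicator (ball 0 R) y * w y))
     (ln R * (2 * pi * R * deriv bessel_I0 (k * R) / k)
       - (2 * pi / k\<^sup>2 * bessel_I0 (k * R) - 2 * pi / k\<^sup>2 * bessel_I0 (k * norm x)))"
  proof (rule radial_layer_cake[where G = ln and g = "\<lambda>t. 1 / t"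
        and W = "\<lambda>t. 2 * pi * t * deriv bessel_I0 (k * t) / k" and H = "\<lambda>t. 2 * pi / k\<^sup>2 * bessel_I0 (k * t)"])
    show "(LINT y|lborel. indicator (ball 0 t) y * w y) = 2 * pi * t * deriv bessel_I0 (k * t) / k"
      if "norm x \<le> t" "t \<le> R" for t
      unfolding w_def using k(1) order_trans[OF norm_ge_zero that(1)] by (rule integral_bessel_disc)
    show "integrable lborel (\<lambda>y. indicator (ball 0 R) y * w y)"
      using int1 by (simp add: F_norm)
    fix t assume t: "norm x \<le> t" "t \<le> R"
    then have "t > 0" using a by linarith
    then show "(ln has_real_derivative 1 / t) (at t)" "0 \<le> 1 / t"
      "((\<lambda>t. 2 * pi / k\<^sup>2 * bessel_I0 (k * t)) has_real_derivative 1 / t * (2 * pi * t * deriv bessel_I0 (k * t) / k)) (at t)"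
      by (simp_all only: DERIV_ln_divide dH zero_le_divide_1_iff less_imp_le)
  qed (use a w_nonneg in simp_all)
  then have cake: "integrable lborel (\<lambda>y :: real ^ 2. ln (max (norm x) (norm y)) * F (norm y))"
    "(LINT y :: real ^ 2|lborel. ln (max (norm x) (norm y)) * F (norm y))
     = ln R * (2 * pi * R * deriv bessel_I0 (k * R) / k)
       - (2 * pi / k\<^sup>2 * bessel_I0 (k * R) - 2 * pi / k\<^sup>2 * bessel_I0 (k * norm x))"
    by (simp_all only: has_bochner_integral_iff F_norm)
  have "(LINT y|disc R. log_kernel x y * bessel_I0 (k * norm y))
      = (LINT y|lborel. indicator (ball 0 R) y * (log_kernel x y * w y))"
    unfolding w_def by (rule integral_disc) (simp add: log_kernel_def[abs_def])
  also have "\<dots> = (LINT y|lborel. - (ln (norm (x - y)) * F (norm y)))"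
    by (intro Bochner_Integration.integral_cong) (auto simp: log_kernel_def ln_div F_norm)
  also have "\<dots> = - (LINT y :: real ^ 2|lborel. ln (max (norm x) (norm y)) * F (norm y))"
    using integral_ln_dist_radial[where F = F and x = x and B = R, OF _ a(2) _ int1 int cake(1)]
    by (simp add: F_def)
  also have "\<dots> = - (2 * pi / k\<^sup>2 * (ln R * mu0 R * deriv bessel_I0 (mu0 R) - bessel_I0 (mu0 R))
      + 2 * pi / k\<^sup>2 * bessel_I0 (k * norm x))"
    unfolding cake(2) k(2)[symmetric] using k(1) by (simp add: power2_eq_square field_simps)
  also have "ln R * mu0 R * deriv bessel_I0 (mu0 R) - bessel_I0 (mu0 R) = 0"
    using mu(2) by simp
  finally show ?thesis by simp
qed

section \<open>The bottom of the spectrum on a disc\<close>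

lemma L2_disc: "L2 (ball 0 R) = {u. sq_integrable (disc R) u}"
  by (auto simp: L2_def sq_integrable_def)

lemma borel_measurable_disc_AE:
  fixes u v :: "real ^ 2 \<Rightarrow> real"
  assumes v: "v \<in> borel_measurable (disc R)" and ae: "AE x in disc R. u x = v x"
  shows "u \<in> borel_measurable (disc R)"
proof -
  have "(\<lambda>x. if x \<in> ball 0 R then v x else 0) \<in> borel_measurable lebesgue"
    by (intro borel_measurable_if_I v) simp
  moreover have "AE x in lebesgue. x \<in> ball 0 R \<longrightarrow> u x = v x"
    using ae by (simp add: AE_restrict_space_iff)
  then have "AE x in lebesgue. (if x \<in> ball 0 R then v x else 0) = (if x \<in> ball 0 R then u x else 0)"
    by eventually_elim auto
  ultimately have "(\<lambda>x. if x \<in> ball 0 R then u x else 0) \<in> borel_measurable lebesgue"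
    by (rule borel_measurable_AE)
  then show ?thesis
    by (rule borel_measurable_if_D)
qed

lemma one_negative_direction_disc:
  assumes R: "R > 1"
  shows "one_negative_direction (disc R) log_kernel (pi / 2 + 2 * R * (pi * R\<^sup>2))
           (\<lambda>x. bessel_I0 (mu0 R / R * norm x)) (2 * pi * (R\<^sup>2 / (mu0 R)\<^sup>2))"
proof (intro one_negative_direction.intro one_negative_direction_axioms.intro schur_kernel_log)
  interpret finite_measure "disc R"
    by (rule finite_measure_disc)
  have mu: "mu0 R > 0"
    using mu0_root_mu0[OF R] by (simp add: mu0_root_def)
  define w where "w x = bessel_I0 (mu0 R / R * norm x)" for x :: "real ^ 2"
  show "R > 0" using R by simp
  show "2 * pi * (R\<^sup>2 / (mu0 R)\<^sup>2) > 0" using R mu by simp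
  show "schur_kernel.form (disc R) log_kernel u u \<ge> 0"
    if "sq_integrable (disc R) u" "(LINT x|disc R. u x) = 0" for u
    using that R by (intro log_form_nonneg) auto
  have [measurable]: "w \<in> borel_measurable (disc R)"
    by (rule borel_measurable_discI) (simp add: w_def[abs_def])
  have w_ge: "w x \<ge> 1" for x
    using bessel_I0_ge_1 mu R by (simp add: w_def)
  have w_le: "w x \<le> bessel_I0 (mu0 R)" if "x \<in> ball 0 R" for x
    unfolding w_def using that mu R
    by (intro bessel_I0_mono) (auto simp: field_simps intro: mult_right_mono)
  have w2: "integrable (disc R) (\<lambda>x. (w x)\<^sup>2)"
  proof (rule integrable_const_bound)
    show "AE x in disc R. norm ((w x)\<^sup>2) \<le> (bessel_I0 (mu0 R))\<^sup>2"
      using w_le w_ge by (intro AE_I2) (auto simp: space_disc intro!: power_mono order_trans[OF zero_le_one])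
  qed measurable
  then show "sq_integrable (disc R) (\<lambda>x. bessel_I0 (mu0 R / R * norm x))"
    unfolding sq_integrable_def w_def[symmetric] by simp
  have "0 < measure lborel (ball 0 R :: (real ^ 2) set)"
    using R by simp
  also have "\<dots> = (LINT x|disc R. 1)"
    by (simp add: measure_restrict_space)
  also have "\<dots> \<le> (LINT x|disc R. (w x)\<^sup>2)"
    using w2 w_ge by (intro integral_mono) auto
  finally show "0 < (LINT x|disc R. (bessel_I0 (mu0 R / R * norm x))\<^sup>2)"
    by (simp add: w_def)
  have eq: "2 * pi * (R\<^sup>2 / (mu0 R)\<^sup>2) = 2 * pi / (mu0 R / R)\<^sup>2"
    by (simp add: power_divide)
  show "AE x in disc R. (LINT y|disc R. log_kernel x y * bessel_I0 (mu0 R / R * norm y))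
      = - (2 * pi * (R\<^sup>2 / (mu0 R)\<^sup>2)) * bessel_I0 (mu0 R / R * norm x)"
    unfolding AE_disc_iff eq using AE_lborel_singleton[of 0]
    by eventually_elim (use log_potential_bessel[OF R] in blast)
qed

theorem theorem1p10:
  shows "(\<forall>R > 1.
            (\<exists>!t. mu0_root R t) \<and>
            (\<forall>\<tau>. \<tau> < 0 \<and> eigenvalue (ball 0 R) \<tau> \<longleftrightarrow> \<tau> = tau1 (ball 0 R)) \<and>
            tau1 (ball 0 R) = - (R\<^sup>2 / (mu0 R)\<^sup>2) \<and>
            (\<forall>u. eigenfunction (ball 0 R) (tau1 (ball 0 R)) u \<longleftrightarrow>
               (\<exists>c. c \<noteq> 0 \<and>
                  (AE x in lebesgue_on (ball 0 R). u x = c * bessel_I0 (mu0 R / R * norm x)))))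
         \<and> (\<forall>R1 R2. 1 < R1 \<and> R1 < R2 \<longrightarrow> mu0 R2 < mu0 R1)"
proof (intro conjI allI impI)
  show "mu0 R2 < mu0 R1" if "1 < R1 \<and> R1 < R2" for R1 R2
    using that by (intro mu0_antimono) auto
next
  fix R :: real
  assume R: "R > 1"
  show "\<exists>!t. mu0_root R t"
    by (rule ex1_mu0_root[OF R])
  define w where "w x = bessel_I0 (mu0 R / R * norm x)" for x :: "real ^ 2"
  define lam where "lam = R\<^sup>2 / (mu0 R)\<^sup>2"
  interpret one_negative_direction "disc R" log_kernel "pi / 2 + 2 * R * (pi * R\<^sup>2)" w "2 * pi * lam"
    using one_negative_direction_disc[OF R] by (simp add: w_def[abs_def] lam_def)
  have lam: "lam > 0"
    using \<kappa>_pos by (simp add: zero_less_mult_iff)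
  have energy: "log_energy (ball 0 R) u = form u u / (2 * pi)" for u
    by (simp add: log_energy_def form_def log_kernel_def)
  have potential: "log_potential (ball 0 R) u x = \<tau> * u x
      \<longleftrightarrow> (LINT y|disc R. log_kernel x y * u y) = 2 * pi * \<tau> * u x" for u x \<tau>
    by (auto simp: log_potential_def log_kernel_def field_simps)
  have norm1: "L2_norm (ball 0 R) u = 1 \<longleftrightarrow> (LINT x|disc R. (u x)\<^sup>2) = 1" for u
    by (simp add: L2_norm_def)
  have eigen: "eigenfunction (ball 0 R) \<tau> u \<longleftrightarrow> sq_integrable (disc R) u \<and> \<not> (AE x in disc R. u x = 0)
      \<and> (AE x in disc R. (LINT y|disc R. log_kernel x y * u y) = 2 * pi * \<tau> * u x)" for \<tau> u
    by (simp add: eigenfunction_def L2_disc potential)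
  have multiple: "sq_integrable (disc R) (\<lambda>x. c * w x)" for c
    using sq_integrable_lincomb[OF w_sq w_sq, of c 0] by simp
  have tau1: "tau1 (ball 0 R) = - lam"
    unfolding tau1_def
  proof (rule cInf_eq_minimum)
    \<comment> \<open>The infimum is attained at the normalized eigenfunction.\<close>
    define c where "c = 1 / sqrt (LINT x|disc R. (w x)\<^sup>2)"
    have c: "c\<^sup>2 * (LINT x|disc R. (w x)\<^sup>2) = 1"
      using w_pos by (simp add: c_def power_divide)
    have "form (\<lambda>x. c * w x) (\<lambda>x. c * w x) = c\<^sup>2 * form w w"
      using form_lincomb_square[OF w_sq w_sq, of c 0] by simp
    also have "\<dots> = - (2 * pi * lam) * (c\<^sup>2 * (LINT x|disc R. (w x)\<^sup>2))"
      using form_w[OF w_sq] by (simp add: power2_eq_square)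
    finally have "log_energy (ball 0 R) (\<lambda>x. c * w x) = - lam"
      unfolding c energy by simp
    moreover have "L2_norm (ball 0 R) (\<lambda>x. c * w x) = 1"
      using c by (simp add: norm1 power_mult_distrib)
    ultimately show "- lam \<in> {log_energy (ball 0 R) u |u. u \<in> L2 (ball 0 R) \<and> L2_norm (ball 0 R) u = 1}"
      using multiple[of c] by (auto simp: L2_disc intro!: exI[of _ "\<lambda>x. c * w x"])
    fix e assume "e \<in> {log_energy (ball 0 R) u |u. u \<in> L2 (ball 0 R) \<and> L2_norm (ball 0 R) u = 1}"
    then obtain u where "e = form u u / (2 * pi)" "sq_integrable (disc R) u" "(LINT x|disc R. (u x)\<^sup>2) = 1"
      by (auto simp: energy L2_disc norm1)
    with form_lower_bound[of u] have "2 * pi * (- lam) \<le> 2 * pi * e"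
      by simp
    then show "- lam \<le> e"
      by (subst (asm) mult_le_cancel_left_pos) simp_all
  qed
  then show "tau1 (ball 0 R) = - (R\<^sup>2 / (mu0 R)\<^sup>2)"
    by (simp add: lam_def)
  have eigen_iff: "eigenfunction (ball 0 R) (- lam) u \<longleftrightarrow> (\<exists>c. c \<noteq> 0 \<and> (AE x in disc R. u x = c * w x))" for u
  proof
    assume "eigenfunction (ball 0 R) (- lam) u"
    then show "\<exists>c. c \<noteq> 0 \<and> (AE x in disc R. u x = c * w x)"
      using negative_eigenfunction(2)[of u "2 * pi * (- lam)"] lam by (auto simp: eigen)
  next
    assume "\<exists>c. c \<noteq> 0 \<and> (AE x in disc R. u x = c * w x)"
    then obtain c where c: "c \<noteq> 0" and u: "AE x in disc R. u x = c * w x" by blast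
    have [measurable]: "w \<in> borel_measurable (disc R)"
      by (rule sq_integrable_measurable[OF w_sq])
    have [measurable]: "u \<in> borel_measurable (disc R)"
      by (rule borel_measurable_disc_AE[OF _ u]) simp
    have "integrable (disc R) (\<lambda>x. (u x)\<^sup>2) \<longleftrightarrow> integrable (disc R) (\<lambda>x. (c * w x)\<^sup>2)"
    proof (rule integrable_cong_AE)
      show "AE x in disc R. (u x)\<^sup>2 = (c * w x)\<^sup>2"
        using u by eventually_elim simp
    qed measurable
    then have "sq_integrable (disc R) u"
      using multiple[of c] by (simp add: sq_integrable_def)
    moreover have "\<not> (AE x in disc R. u x = 0)"
    proof
      assume "AE x in disc R. u x = 0"
      with u have "AE x in disc R. w x = 0"
        by eventually_elim (use c in simp)
      then show False
        using sq_integral_zero_iff[OF w_sq] w_pos by simp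
    qed
    moreover have "AE x in disc R. (LINT y|disc R. log_kernel x y * u y) = 2 * pi * (- lam) * u x"
      using w_eigen u AE_space
    proof eventually_elim
      fix x assume *: "(LINT y|disc R. log_kernel x y * w y) = - (2 * pi * lam) * w x" "u x = c * w x"
      have [measurable]: "log_kernel x \<in> borel_measurable (disc R)"
        by (rule borel_measurable_discI) (simp add: log_kernel_def[abs_def])
      have "(LINT y|disc R. log_kernel x y * u y) = (LINT y|disc R. c * (log_kernel x y * w y))"
      proof (rule integral_cong_AE)
        show "AE y in disc R. log_kernel x y * u y = c * (log_kernel x y * w y)"
          using u by eventually_elim simp
      qed measurable
      then show "(LINT y|disc R. log_kernel x y * u y) = 2 * pi * (- lam) * u x"
        using * by simp
    qed
    ultimately show "eigenfunction (ball 0 R) (- lam) u"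
      by (simp add: eigen)
  qed
  then show "eigenfunction (ball 0 R) (tau1 (ball 0 R)) u \<longleftrightarrow>
      (\<exists>c. c \<noteq> 0 \<and> (AE x in lebesgue_on (ball 0 R). u x = c * bessel_I0 (mu0 R / R * norm x)))" for u
    by (simp add: tau1 w_def)
  show "\<tau> < 0 \<and> eigenvalue (ball 0 R) \<tau> \<longleftrightarrow> \<tau> = tau1 (ball 0 R)" for \<tau>
  proof
    assume "\<tau> < 0 \<and> eigenvalue (ball 0 R) \<tau>"
    then obtain u where "\<tau> < 0" "eigenfunction (ball 0 R) \<tau> u"
      by (auto simp: eigenvalue_def)
    then have "2 * pi * \<tau> = - (2 * pi * lam)"
      by (intro negative_eigenfunction(1)[of u]) (auto simp: eigen mult_less_0_iff)
    then have "2 * pi * \<tau> = 2 * pi * (- lam)" by simp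
    then show "\<tau> = tau1 (ball 0 R)"
      unfolding tau1 by (subst (asm) mult_cancel_left) simp
  next
    assume "\<tau> = tau1 (ball 0 R)"
    moreover have "eigenfunction (ball 0 R) (- lam) w"
      unfolding eigen_iff by (rule exI[of _ 1]) simp
    ultimately show "\<tau> < 0 \<and> eigenvalue (ball 0 R) \<tau>"
      using lam by (auto simp: tau1 eigenvalue_def)
  qed
qed

end
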